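(* Let $\ell>0$, let $\mathcal{V}=(v_1,\dots,v_V)\in\mathbb{R}^{3V}$ be a closed space polygon with $\mathrm{CThi}(\ell,\mathcal{V})=1$, and let $W=(w_1,\dots,w_V)\in\mathbb{R}^{3V}$ be a variation of $\mathcal{V}$, with $\mathcal{V}_t=\mathcal{V}+tW$. View each pair of points $(p,q)$ on $\mathcal{V}$ and each $\mathrm{MinRad}^{\pm}(v_i)$ as functions of $t$. Then the forward time derivative $\left.\frac{d}{dt^+}\mathrm{CThi}(\ell,\mathcal{V}_t)\right|_{t=0}$ exists and $$D_W\mathrm{CThi}(\ell,\mathcal{V})=\left.\frac{d}{dt^+}\mathrm{CThi}(\ell,\mathcal{V}_t)\right|_{t=0}=\min\left\{\min_{(v_i,\pm)\in\mathrm{Kink}(\mathcal{V})}\left.\frac{d}{dt^+}\big(\mathrm{MinRad}^{\pm}v_i\big)(t)\right|_{t=0},\ \min_{(p,q)\in\mathrm{Strut}(\mathcal{V})}\left.\frac{d}{dt^+}\frac{d(p(t),q(t))}{2}\right|_{t=0}\right\}.$$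
   Context: A closed space polygon $\mathcal{V}$ (possibly with several components) has vertices $v_1,\dots,v_V\in\mathbb{R}^3$ and edges $e_1,\dots,e_V$, where $e_{i-1},e_i$ are the edges meeting at $v_i$ (indices cyclic on each component). $\theta_i$ denotes the turning angle at $v_i$. $\mathrm{MinRad}(v_i)=\min\{\mathrm{MinRad}^-(v_i),\mathrm{MinRad}^+(v_i)\}$ with $\mathrm{MinRad}^-(v_i)=\frac{|e_{i-1}|}{2\tan(\theta_i/2)}$ and $\mathrm{MinRad}^+(v_i)=\frac{|e_i|}{2\tan(\theta_i/2)}$; vertices with $\theta_i=0$, where these are undefined (infinite), are ignored in minima. For points $p,q$ on $\mathcal{V}$, $d(p,q)=\|p-q\|$. Let $\theta(1,\ell)=2\arctan(\ell/2)$. Let $\mathrm{vb}(p,q)$ be $\infty$ if $p,q$ lie on different components of $\mathcal{V}$, and otherwise the smaller (over the two arcs joining $p$ and $q$) of the number of vertices between $p$ and $q$, counting $p$ and/or $q$ if they are vertices. Set $\mathrm{VB}(1,\ell)=\{(p,q)\in\mathcal{V}\times\mathcal{V}: \mathrm{vb}(p,q)\ge \pi/\theta(1,\ell)\}$. The constraint thickness is $$\mathrm{CThi}(\ell,\mathcal{V})=\min\Big\{\min_i \mathrm{MinRad}(v_i),\ \min_{(p,q)\in \mathrm{VB}(1,\ell)}\tfrac{d(p,q)}{2}\Big\}.$$ $\mathrm{Strut}(\mathcal{V})$ is the set of pairs $(p,q)\in\mathrm{VB}(1,\ell)$ with $d(p,q)/2=1$ such that either $(p,q)$ is an isolated local minimum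 of $d$ (as a function on $\mathrm{VB}(1,\ell)$), or $(p,q)$ is an endpoint of a family (a nondegenerate interval of corresponding pairs, lying on two parallel edges) of local minima of $d$. $\mathrm{Kink}(\mathcal{V})$ is the set of pairs $(v_i,\pm)$ with $\mathrm{MinRad}^{\pm}(v_i)=1$. Under a variation $W$, $\mathcal{V}_t=(v_1+tw_1,\dots,v_V+tw_V)$; a point $p=\alpha v_i+(1-\alpha)v_{i+1}$ of $\mathcal{V}$ moves as $p(t)=\alpha(v_i+tw_i)+(1-\alpha)(v_{i+1}+tw_{i+1})$, and $(\mathrm{MinRad}^{\pm}v_i)(t)$ is the value of $\mathrm{MinRad}^\pm$ at the $i$-th vertex of $\mathcal{V}_t$. A minimum over the empty set is omitted. *)

theory Defs
  imports "HOL-Analysis.Analysis"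
begin

section \<open>Closed polygons and variations\<close>

text \<open>
  A polygon, or a variation field on it, is the list of its components, each component being
  the list of its vertices, respectively of the vectors at these vertices. Vertex and edge
  indices are integers, read cyclically on each component; edge \<open>k\<close> runs from vertex \<open>k\<close> to
  vertex \<open>k + 1\<close>.
\<close>

type_synonym polygon = "(real ^ 3) list list"

definition nverts :: "polygon \<Rightarrow> nat \<Rightarrow> int" where
  "nverts V c = int (length (V ! c))"

definition vtx :: "polygon \<Rightarrow> nat \<Rightarrow> int \<Rightarrow> real ^ 3" where
  "vtx V c k = V ! c ! nat (k mod nverts V c)"

definition edge :: "polygon \<Rightarrow> nat \<Rightarrow> int \<Rightarrow> real ^ 3" where
  "edge V c k = vtx V c (k + 1) - vtx V c k"

definition is_vertex :: "polygon \<Rightarrow> nat \<Rightarrow> int \<Rightarrow> bool" where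
  "is_vertex V c k \<longleftrightarrow> c < length V \<and> 0 \<le> k \<and> k < nverts V c"

text \<open>Edges are nonzero, so that turning angles make sense. No embeddedness is required.\<close>

definition closed_polygon :: "polygon \<Rightarrow> bool" where
  "closed_polygon V \<longleftrightarrow>
     V \<noteq> [] \<and> (\<forall>c < length V. V ! c \<noteq> []) \<and> (\<forall>c k. is_vertex V c k \<longrightarrow> edge V c k \<noteq> 0)"

definition vary :: "polygon \<Rightarrow> polygon \<Rightarrow> real \<Rightarrow> polygon" where
  "vary V W t = map2 (map2 (\<lambda>v w. v + t *\<^sub>R w)) V W"


section \<open>Turning angles and MinRad\<close>

definition turn :: "polygon \<Rightarrow> nat \<Rightarrow> int \<Rightarrow> real" where
  "turn V c k =
     arccos ((edge V c (k - 1) \<bullet> edge V c k) / (norm (edge V c (k - 1)) * norm (edge V c k)))"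

datatype side = Minus | Plus

text \<open>
  If the turning angle is \<open>\<pi>\<close>, then \<open>tan (pi / 2) = 0\<close> and division by zero yield the
  mathematically correct limit value \<open>0\<close>. If the turning angle is \<open>0\<close>, the value is the
  meaningless \<open>0\<close> instead of \<open>\<infinity>\<close>; such vertices are excluded wherever these numbers are used.
\<close>

definition min_rad_side :: "side \<Rightarrow> polygon \<Rightarrow> nat \<Rightarrow> int \<Rightarrow> real" where
  "min_rad_side s V c k =
     norm (case s of Minus \<Rightarrow> edge V c (k - 1) | Plus \<Rightarrow> edge V c k) / (2 * tan (turn V c k / 2))"

definition min_rad :: "polygon \<Rightarrow> nat \<Rightarrow> int \<Rightarrow> real" where
  "min_rad V c k = min (min_rad_side Minus V c k) (min_rad_side Plus V c k)"


section \<open>Points of a polygon\<close>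

text \<open>
  Points are intrinsic points of the curve: \<open>(c, s)\<close> with \<open>0 \<le> s < n\<close>, where \<open>n\<close> is the number of
  vertices of component \<open>c\<close>, stands for the point \<open>(1 - frac s) v\<^sub>k + frac s v\<^sub>k\<^sub>+\<^sub>1\<close> with
  \<open>k = \<lfloor>s\<rfloor>\<close>. So points where the polygon crosses itself are told apart, and a point moves
  along with a variation by keeping its parameter.
\<close>

type_synonym point = "nat \<times> real"

definition points :: "polygon \<Rightarrow> point set" where
  "points V = {(c, s). c < length V \<and> 0 \<le> s \<and> s < of_int (nverts V c)}"

definition pos :: "polygon \<Rightarrow> point \<Rightarrow> real ^ 3" where
  "pos V p = (case p of (c, s) \<Rightarrow>
     (1 - frac s) *\<^sub>R vtx V c \<lfloor>s\<rfloor> + frac s *\<^sub>R vtx V c (\<lfloor>s\<rfloor> + 1))"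

definition d :: "polygon \<Rightarrow> point \<Rightarrow> point \<Rightarrow> real" where
  "d V p q = dist (pos V p) (pos V q)"

text \<open>Closeness of points in the topology of the curve, a disjoint union of circles.\<close>

definition near :: "polygon \<Rightarrow> real \<Rightarrow> point \<Rightarrow> point \<Rightarrow> bool" where
  "near V \<epsilon> p q \<longleftrightarrow>
     fst p = fst q \<and> (\<exists>j::int. \<bar>snd p - snd q + of_int (j * nverts V (fst p))\<bar> < \<epsilon>)"

text \<open>The point with parameter \<open>s\<close>, where \<open>s\<close> may lie outside the standard range.\<close>

definition point_at :: "polygon \<Rightarrow> nat \<Rightarrow> real \<Rightarrow> point" where
  "point_at V c s = (c, s - of_int (nverts V c) * of_int \<lfloor>s / of_int (nverts V c)\<rfloor>)"


section \<open>Constraint thickness\<close>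

text \<open>
  The arcs joining the parameters \<open>s\<close> and \<open>s'\<close> are \<open>[lo, hi]\<close> and \<open>[hi, lo + n]\<close> with
  \<open>lo\<close> and \<open>hi\<close> the smaller and the larger of \<open>s\<close> and \<open>s'\<close>, and the vertices on them are the
  integers.
\<close>

definition vb :: "polygon \<Rightarrow> point \<Rightarrow> point \<Rightarrow> ereal" where
  "vb V p q =
     (if fst p \<noteq> fst q then \<infinity>
      else
        let lo = min (snd p) (snd q); hi = max (snd p) (snd q); n = nverts V (fst p)
        in ereal (min (of_nat (card {k::int. lo \<le> of_int k \<and> of_int k \<le> hi}))
                      (of_nat (card {k::int. hi \<le> of_int k \<and> of_int k \<le> lo + of_int n}))))"

definition theta1 :: "real \<Rightarrow> real" where
  "theta1 l = 2 * arctan (l / 2)"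

definition VB :: "real \<Rightarrow> polygon \<Rightarrow> (point \<times> point) set" where
  "VB l V = {(p, q). p \<in> points V \<and> q \<in> points V \<and> vb V p q \<ge> ereal (pi / theta1 l)}"

text \<open>
  The infimum is a minimum: there are finitely many vertices, and \<open>VB\<close> is compact. For a closed
  polygon the first of the two sets is nonempty.
\<close>

definition CThi :: "real \<Rightarrow> polygon \<Rightarrow> real" where
  "CThi l V =
     Inf ({min_rad V c k | c k. is_vertex V c k \<and> turn V c k \<noteq> 0} \<union>
          {d V p q / 2 | p q. (p, q) \<in> VB l V})"


section \<open>Kinks and struts\<close>

definition Kink :: "polygon \<Rightarrow> (nat \<times> int \<times> side) set" where
  "Kink V = {(c, k, s). is_vertex V c k \<and> turn V c k \<noteq> 0 \<and> min_rad_side s V c k = 1}"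

definition local_min :: "real \<Rightarrow> polygon \<Rightarrow> point \<times> point \<Rightarrow> bool" where
  "local_min l V z \<longleftrightarrow> z \<in> VB l V \<and>
     (\<exists>\<epsilon>>0. \<forall>(p, q) \<in> VB l V. near V \<epsilon> (fst z) p \<and> near V \<epsilon> (snd z) q \<longrightarrow>
        d V (fst z) (snd z) \<le> d V p q)"

definition isolated_local_min :: "real \<Rightarrow> polygon \<Rightarrow> point \<times> point \<Rightarrow> bool" where
  "isolated_local_min l V z \<longleftrightarrow> local_min l V z \<and>
     (\<exists>\<epsilon>>0. \<forall>p q. local_min l V (p, q) \<and> near V \<epsilon> (fst z) p \<and> near V \<epsilon> (snd z) q \<longrightarrow>
        (p, q) = z)"

text \<open>
  The pairs \<open>(point_at V c x, point_at V c' y)\<close>, for \<open>(x, y)\<close> on the segment from \<open>a\<close> to \<open>b\<close>,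
  form a family of local minima on the parallel closed edges \<open>(c, i)\<close> and \<open>(c', j)\<close>.
  The segment lies in the parameter square of the two edges and runs through a nondegenerate
  interval on each of them.
\<close>

definition min_family ::
    "real \<Rightarrow> polygon \<Rightarrow> nat \<Rightarrow> int \<Rightarrow> nat \<Rightarrow> int \<Rightarrow> real \<times> real \<Rightarrow> real \<times> real \<Rightarrow> bool" where
  "min_family l V c i c' j a b \<longleftrightarrow>
     is_vertex V c i \<and> is_vertex V c' j \<and>
     (\<exists>r. edge V c i = r *\<^sub>R edge V c' j) \<and>
     fst a \<noteq> fst b \<and> snd a \<noteq> snd b \<and>
     closed_segment a b \<subseteq>
       {of_int i .. of_int (i + 1)} \<times> {of_int j .. of_int (j + 1)} \<and>
     (\<forall>(x, y) \<in> closed_segment a b. local_min l V (point_at V c x, point_at V c' y))"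

text \<open>
  Only maximal families count; otherwise every pair of a family would be an endpoint of one of
  its subfamilies. Since \<open>a\<close> and \<open>b\<close> can be exchanged, \<open>a\<close> is an arbitrary endpoint.
\<close>

definition family_endpoint :: "real \<Rightarrow> polygon \<Rightarrow> point \<times> point \<Rightarrow> bool" where
  "family_endpoint l V z \<longleftrightarrow>
     (\<exists>c i c' j a b. min_family l V c i c' j a b \<and>
        (\<forall>a' b'. min_family l V c i c' j a' b' \<and> closed_segment a b \<subseteq> closed_segment a' b' \<longrightarrow>
           closed_segment a' b' = closed_segment a b) \<and>
        z = (point_at V c (fst a), point_at V c' (snd a)))"

definition Strut :: "real \<Rightarrow> polygon \<Rightarrow> (point \<times> point) set" where
  "Strut l V = {(p, q). (p, q) \<in> VB l V \<and> d V p q / 2 = 1 \<and>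
     (isolated_local_min l V (p, q) \<or> family_endpoint l V (p, q))}"


section \<open>Forward derivatives and minima\<close>

definition fwd_deriv :: "(real \<Rightarrow> real) \<Rightarrow> real" where
  "fwd_deriv f = vector_derivative f (at_right 0)"

definition is_minimum :: "real \<Rightarrow> real set \<Rightarrow> bool" where
  "is_minimum m A \<longleftrightarrow> m \<in> A \<and> (\<forall>x\<in>A. m \<le> x)"

end

theory Submission
  imports Defs
begin

text \<open>
  Near \<open>t = 0\<close>, constraint thickness is the infimum of a family of functions of \<open>t\<close>: finitely many
  radii, and the half distances of the pairs in \<open>VB\<close>, a set that does not depend on the positions
  of the vertices and hence not on \<open>t\<close>. The one-sided derivative of such an infimum is the least
  derivative of the members that attain it at \<open>t = 0\<close>, by the envelope theorem for minima (Danskin),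
  provided that the members are bounded below by lines through their initial values, uniformly up to
  \<open>o(t)\<close>. For the radii this is differentiability at finitely many vertices; a straight vertex may
  start to bend, but its radius is then large (\<open>min_rad_side_vary_straight\<close>). For the distances, the
  chord of a pair is affine in \<open>t\<close>, so its norm is convex and lies above its tangent line exactly
  (\<open>d_vary_lower_bound\<close>). What remains is a compactness argument (\<open>compact_linear_lower_bound\<close>).

  For compactness, the pairs are lifted to the parameter plane, where the number of vertices between
  two points becomes an explicit function of floors and ceilings (\<open>gap\<close>). It is constant on open
  cells of the integer grid and does not decrease when passing to the boundary of a cell, so \<open>VB\<close>
  lifts to a closed union of closed cells.

  The envelope theorem gives a minimum over all contacts, that is, pairs of \<open>VB\<close> at distance \<open>2\<close>,
  and not over the struts alone. Every contact is a global and hence a local minimum of the distance.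
  If it is not isolated, then convexity of the distance on a cell forces a nearby local minimum to be
  a contact as well, with the same chord; hence both points move along parallel edges, and the whole
  line through the two contacts, cut off by the cell, consists of contacts. It is a maximal family.
  The chord is constant on this family, so the slope of the distance under the variation is affine
  along it, and one of the two endpoints, which are struts, has a slope at most as large
  (\<open>contact_slope_dominated\<close>). So the minimum over contacts is attained at a strut.
\<close>

section \<open>One-sided derivatives, minima and convexity\<close>

lemma at_right_eventually_pos: "eventually (\<lambda>t::real. 0 < t) (at_right 0)"
  by (simp add: eventually_at_right_less)

lemma fwd_deriv_eqI: "(f has_vector_derivative D) (at_right 0) \<Longrightarrow> fwd_deriv f = D"
  unfolding fwd_deriv_def by (rule vector_derivative_within) auto

lemma differentiable_fwd:
  fixes f :: "real \<Rightarrow> real"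
  assumes "f differentiable (at 0)"
  shows "(f has_vector_derivative fwd_deriv f) (at_right 0)" "f differentiable (at_right 0)"
proof -
  show "f differentiable (at_right 0)" using assms by (rule differentiable_at_withinI)
  then show "(f has_vector_derivative fwd_deriv f) (at_right 0)"
    unfolding fwd_deriv_def by (simp add: vector_derivative_works[symmetric])
qed

lemma fwd_deriv_sandwich:
  fixes f :: "real \<Rightarrow> real"
  assumes lower: "\<And>e. e > 0 \<Longrightarrow> eventually (\<lambda>t. f 0 + t * (m - e) \<le> f t) (at_right 0)"
    and upper: "\<And>e. e > 0 \<Longrightarrow> eventually (\<lambda>t. f t \<le> f 0 + t * (m + e)) (at_right 0)"
  shows "(f has_vector_derivative m) (at_right 0)"
proof -
  have "((\<lambda>t. (f t - f 0) / (t - 0)) \<longlongrightarrow> m) (at_right 0)"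
  proof (rule tendstoI)
    fix e :: real assume "e > 0"
    then have e2: "e/2 > 0" by simp
    show "eventually (\<lambda>t. dist ((f t - f 0) / (t - 0)) m < e) (at_right 0)"
      using lower[OF e2] upper[OF e2] at_right_eventually_pos
    proof eventually_elim
      case (elim t)
      then have "m - e/2 \<le> (f t - f 0) / t" "(f t - f 0) / t \<le> m + e/2"
        by (simp_all add: field_simps)
      then have "\<bar>(f t - f 0) / t - m\<bar> \<le> e/2" by linarith
      then show ?case using \<open>e > 0\<close> by (simp add: dist_real_def)
    qed
  qed
  then show ?thesis
    by (simp add: has_real_derivative_iff_has_vector_derivative[symmetric] has_field_derivative_iff)
qed

lemma fwd_deriv_bounds:
  fixes f :: "real \<Rightarrow> real"
  assumes "(f has_vector_derivative D) (at_right 0)" and "e > 0"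
  shows "eventually (\<lambda>t. f 0 + t * (D - e) \<le> f t \<and> f t \<le> f 0 + t * (D + e)) (at_right 0)"
proof -
  have "((\<lambda>t. (f t - f 0) / (t - 0)) \<longlongrightarrow> D) (at_right 0)"
    using assms(1)
    by (simp add: has_real_derivative_iff_has_vector_derivative[symmetric] has_field_derivative_iff)
  from tendstoD[OF this \<open>e > 0\<close>] at_right_eventually_pos show ?thesis
  proof eventually_elim
    case (elim t)
    then have "\<bar>(f t - f 0) / t - D\<bar> < e" by (simp add: dist_real_def)
    then have "D - e \<le> (f t - f 0) / t" "(f t - f 0) / t \<le> D + e" by linarith+
    then show ?case using elim by (simp add: field_simps)
  qed
qed

text \<open>
  The lower half of the envelope theorem. Members whose slope is at least \<open>m - e\<close> satisfy the bound at
  once. The others form a compact set without active members, so their initial values exceed \<open>a\<close> by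
  a uniform amount, which outweighs their slopes for small \<open>t\<close>.
\<close>

lemma compact_linear_lower_bound:
  fixes g h :: "'a::t2_space \<Rightarrow> real"
  assumes K: "compact K" and g: "continuous_on K g" and h: "continuous_on K h"
    and ge: "\<And>z. z \<in> K \<Longrightarrow> a \<le> g z"
    and active: "\<And>z. z \<in> K \<Longrightarrow> g z = a \<Longrightarrow> m \<le> h z"
    and "e > 0"
  shows "eventually (\<lambda>t. \<forall>z\<in>K. a + t * (m - e) \<le> g z + t * h z) (at_right 0)"
proof (cases "{z\<in>K. h z \<le> m - e} = {}")
  case True
  show ?thesis
    using at_right_eventually_pos
  proof eventually_elim
    case (elim t)
    show ?case
    proof
      fix z assume "z \<in> K"
      with True have "m - e \<le> h z" by force
      then have "t * (m - e) \<le> t * h z" using elim by simp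
      then show "a + t * (m - e) \<le> g z + t * h z" using ge[OF \<open>z \<in> K\<close>] by linarith
    qed
  qed
next
  case False
  define K' where "K' = {z\<in>K. h z \<le> m - e}"
  have sub: "K' \<subseteq> K" by (auto simp: K'_def)
  have "closed K'" unfolding K'_def
    by (intro continuous_on_closed_Collect_le h continuous_on_const compact_imp_closed K)
  then have K': "compact K'"
    using compact_Int_closed[OF K, of K'] sub by (simp add: Int_absorb1)
  obtain z0 where z0: "z0 \<in> K'" "\<And>z. z \<in> K' \<Longrightarrow> g z0 \<le> g z"
    using continuous_attains_inf[OF K' _ continuous_on_subset[OF g sub]] False
    unfolding K'_def by blast
  obtain z1 where z1: "\<And>z. z \<in> K \<Longrightarrow> h z1 \<le> h z"
    using continuous_attains_inf[OF K _ h] False by blast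
  have "g z0 \<noteq> a" using z0(1) active[of z0] \<open>e > 0\<close> by (auto simp: K'_def)
  then have gap: "a < g z0" using ge[of z0] z0(1) sub by force
  have "((\<lambda>t. a + t * (m - e - h z1)) \<longlongrightarrow> a + 0 * (m - e - h z1)) (at_right 0)"
    by (intro tendsto_intros)
  then have "eventually (\<lambda>t. a + t * (m - e - h z1) < g z0) (at_right 0)"
    using gap by (intro order_tendstoD(2)) auto
  then show ?thesis
    using at_right_eventually_pos
  proof eventually_elim
    case (elim t)
    show ?case
    proof
      fix z assume z: "z \<in> K"
      show "a + t * (m - e) \<le> g z + t * h z"
      \<comment> \<open>On \<open>K'\<close> the slope may be too small, but \<open>g\<close> starts above \<open>a\<close> by a uniform amount.\<close>
      proof (cases "z \<in> K'")
        case True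
        have "t * h z1 \<le> t * h z" using z1[OF z] elim by simp
        moreover have "a + t * (m - e) - t * h z1 < g z0" using elim by (simp add: algebra_simps)
        ultimately show ?thesis using z0(2)[OF True] by linarith
      next
        case False
        then have "t * (m - e) \<le> t * h z" using elim z by (simp add: K'_def)
        then show ?thesis using ge[OF z] by linarith
      qed
    qed
  qed
qed

lemma compact_has_minimum:
  assumes "compact (A :: real set)" "A \<noteq> {}"
  obtains m where "is_minimum m A"
  using compact_attains_inf[OF assms] by (auto simp: is_minimum_def)

text \<open>
  A norm is convex, so it lies above its tangent along a line.
\<close>

lemma norm_line_lower_bound:
  fixes D E :: "'a::real_inner"
  assumes "D \<noteq> 0"
  shows "norm D + t * (E \<bullet> D / norm D) \<le> norm (D + t *\<^sub>R E)"
proof -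
  have "(D + t *\<^sub>R E) \<bullet> D \<le> norm (D + t *\<^sub>R E) * norm D" by (rule norm_cauchy_schwarz)
  then have "norm D * norm D + t * (E \<bullet> D) \<le> norm (D + t *\<^sub>R E) * norm D"
    by (simp add: inner_add_left power2_norm_eq_inner[symmetric] power2_eq_square)
  then show ?thesis using assms by (simp add: field_simps)
qed

lemma norm_line_has_vector_derivative:
  fixes D E :: "'a::real_inner"
  assumes "D \<noteq> 0"
  shows "((\<lambda>t. norm (D + t *\<^sub>R E)) has_vector_derivative E \<bullet> D / norm D) (at_right 0)"
proof -
  have "((\<lambda>t. D + t *\<^sub>R E) has_derivative (\<lambda>t. t *\<^sub>R E)) (at_right 0)"
    by (auto intro!: derivative_eq_intros)
  moreover have "(norm has_derivative (\<lambda>h. h \<bullet> sgn D)) (at (D + 0 *\<^sub>R E))"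
    using has_derivative_norm[OF assms] by simp
  ultimately have "((\<lambda>t. norm (D + t *\<^sub>R E)) has_derivative (\<lambda>t. (t *\<^sub>R E) \<bullet> sgn D)) (at_right 0)"
    by (rule has_derivative_compose)
  then show ?thesis
    by (simp add: has_vector_derivative_def sgn_div_norm divide_inverse mult.commute mult.left_commute)
qed

text \<open>
  Strict convexity of the Euclidean ball, in the form needed to see that the chord is constant along
  a family of contacts.
\<close>

lemma norm_convex_combination_const:
  fixes D0 D1 :: "'a::real_inner"
  assumes "norm D0 = r" "norm D1 = r" "r \<le> norm ((1/2) *\<^sub>R D0 + (1/2) *\<^sub>R D1)"
  shows "D0 = D1"
proof -
  have "0 \<le> r" using assms(1) by auto
  \<comment> \<open>the parallelogram law\<close>
  have "(norm ((1/2) *\<^sub>R D0 + (1/2) *\<^sub>R D1))\<^sup>2 + (norm (D0 - D1))\<^sup>2 / 4 = ((norm D0)\<^sup>2 + (norm D1)\<^sup>2) / 2"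
    by (simp add: power2_norm_eq_inner inner_add_left inner_add_right inner_diff_left inner_diff_right
        inner_commute field_simps)
  also have "\<dots> = r\<^sup>2" using assms by simp
  finally have "(norm (D0 - D1))\<^sup>2 \<le> 0"
    using power_mono[OF assms(3) \<open>0 \<le> r\<close>, of 2] by linarith
  then show ?thesis by simp
qed

lemma line_in_box:
  fixes x u y v :: real
  assumes "u \<noteq> 0" and 0: "x \<in> {a..b}" "y \<in> {a'..b'}" and 1: "x + u \<in> {a..b}" "y + v \<in> {a'..b'}"
  obtains s0 s1 where "s0 \<le> 0" "1 \<le> s1"
    "\<And>s. x + s * u \<in> {a..b} \<and> y + s * v \<in> {a'..b'} \<longleftrightarrow> s0 \<le> s \<and> s \<le> s1"
proof -
  define T where "T = {s. x + s * u \<in> {a..b} \<and> y + s * v \<in> {a'..b'}}"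
  have "closed T" unfolding T_def atLeastAtMost_iff
    by (intro closed_Collect_conj closed_Collect_le continuous_intros)
  moreover have "bounded T"
  proof (rule boundedI)
    fix s assume "s \<in> T"
    then have "\<bar>s * u\<bar> \<le> b - a" using 0 by (auto simp: T_def abs_le_iff)
    then show "norm s \<le> (b - a) / \<bar>u\<bar>" using \<open>u \<noteq> 0\<close> by (simp add: abs_mult field_simps)
  qed
  ultimately have "compact T" by (simp add: compact_eq_bounded_closed)
  moreover have "convex T"
  proof (rule convexI)
    fix s s' \<mu> \<nu> :: real assume s: "s \<in> T" "s' \<in> T" "0 \<le> \<mu>" "0 \<le> \<nu>" "\<mu> + \<nu> = 1"
    have "\<mu> *\<^sub>R (x + s * u) + \<nu> *\<^sub>R (x + s' * u) \<in> {a..b}" "\<mu> *\<^sub>R (y + s * v) + \<nu> *\<^sub>R (y + s' * v) \<in> {a'..b'}"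
      using s by (intro convexD; simp add: T_def)+
    moreover have "\<mu> *\<^sub>R (z + s * w) + \<nu> *\<^sub>R (z + s' * w) = z + (\<mu> *\<^sub>R s + \<nu> *\<^sub>R s') * w" for z w :: real
    proof -
      have "\<mu> *\<^sub>R (z + s * w) + \<nu> *\<^sub>R (z + s' * w) = (\<mu> + \<nu>) * z + (\<mu> *\<^sub>R s + \<nu> *\<^sub>R s') * w"
        by (simp add: algebra_simps)
      then show ?thesis by (simp add: s(5))
    qed
    ultimately show "\<mu> *\<^sub>R s + \<nu> *\<^sub>R s' \<in> T" by (simp add: T_def)
  qed
  ultimately have "connected T \<and> compact T" by (simp add: convex_connected)
  then obtain s0 s1 where T: "T = {s0..s1}"
    unfolding connected_compact_interval_1 by blast
  have "0 \<in> T" "1 \<in> T" using 0 1 by (auto simp: T_def)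
  moreover have "x + s * u \<in> {a..b} \<and> y + s * v \<in> {a'..b'} \<longleftrightarrow> s0 \<le> s \<and> s \<le> s1" for s
  proof -
    have "s \<in> T \<longleftrightarrow> s \<in> {s0..s1}" by (simp only: T)
    then show ?thesis by (simp only: T_def mem_Collect_eq atLeastAtMost_iff)
  qed
  ultimately show thesis unfolding T by (intro that[of s0 s1]) simp_all
qed

section \<open>The periodic parametrization of a polygon\<close>

text \<open>
  The definition of \<open>pos\<close> makes sense for all real parameters and is periodic in them. Working with
  arbitrary parameters avoids the seam at the first vertex of each component.
\<close>

lemma vtx_shift: "vtx V c (k + m * nverts V c) = vtx V c k"
  by (simp add: vtx_def)

lemma edge_shift: "edge V c (k + m * nverts V c) = edge V c k"
proof -
  have "k + m * nverts V c + 1 = (k + 1) + m * nverts V c" by simp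
  then show ?thesis by (simp only: edge_def vtx_shift)
qed

lemma pos_shift: "pos V (c, x + of_int (m * nverts V c)) = pos V (c, x)"
proof -
  have 1: "\<lfloor>x + of_int (m * nverts V c)\<rfloor> = \<lfloor>x\<rfloor> + m * nverts V c"
    by (rule floor_add_int[symmetric])
  have 2: "frac (x + of_int (m * nverts V c)) = frac x"
    by (simp add: frac_def)
  have 3: "\<lfloor>x\<rfloor> + m * nverts V c + 1 = (\<lfloor>x\<rfloor> + 1) + m * nverts V c" by simp
  show ?thesis by (simp only: pos_def prod.case 1 2 3 vtx_shift)
qed

lemma point_at_shift: "point_at V c x = (c, x + of_int (- \<lfloor>x / of_int (nverts V c)\<rfloor> * nverts V c))"
  by (simp add: point_at_def)

lemma pos_point_at: "pos V (point_at V c x) = pos V (c, x)"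
  by (simp only: point_at_shift pos_shift)

lemma d_point_at: "d V (point_at V c x) (point_at V c' y) = d V (c, x) (c', y)"
  by (simp add: d_def pos_point_at)

lemma nverts_pos: "closed_polygon V \<Longrightarrow> c < length V \<Longrightarrow> 0 < nverts V c"
  by (simp add: closed_polygon_def nverts_def)

lemma edge_nonzero:
  assumes "closed_polygon V" "c < length V"
  shows "edge V c k \<noteq> 0"
proof -
  let ?n = "nverts V c"
  have "edge V c k = edge V c (k mod ?n + (k div ?n) * ?n)"
    by (simp only: mod_div_mult_eq)
  also have "\<dots> = edge V c (k mod ?n)" by (rule edge_shift)
  also have "\<dots> \<noteq> 0"
    using assms nverts_pos[OF assms] by (auto simp: closed_polygon_def is_vertex_def)
  finally show ?thesis .
qed

lemma point_at_in_points:
  assumes "closed_polygon V" "c < length V"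
  shows "point_at V c x \<in> points V"
proof -
  let ?n = "of_int (nverts V c) :: real"
  have n: "?n > 0" using nverts_pos[OF assms] by simp
  have "of_int \<lfloor>x / ?n\<rfloor> * ?n \<le> x / ?n * ?n" "x / ?n * ?n < (of_int \<lfloor>x / ?n\<rfloor> + 1) * ?n"
    using n by (intro mult_right_mono mult_strict_right_mono; linarith)+
  then show ?thesis
    using n assms by (simp add: points_def point_at_def algebra_simps)
qed

lemma point_at_eqI:
  assumes "(c, x) \<in> points V"
  shows "point_at V c (x + of_int (m * nverts V c)) = (c, x)"
proof -
  have n: "0 \<le> x" "x < of_int (nverts V c)" using assms by (auto simp: points_def)
  then have "\<lfloor>(x + of_int (m * nverts V c)) / of_int (nverts V c)\<rfloor> = m"
    by (intro floor_unique) (simp_all add: field_simps)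
  then show ?thesis by (simp add: point_at_def)
qed

lemma pos_on_edge:
  assumes "of_int i \<le> x" "x \<le> of_int i + 1"
  shows "pos V (c, x) = vtx V c i + (x - of_int i) *\<^sub>R edge V c i"
proof (cases "x = of_int i + 1")
  case True
  then have "x = of_int (i + 1)" by simp
  then show ?thesis by (simp add: pos_def edge_def)
next
  case False
  then have "\<lfloor>x\<rfloor> = i" using assms by (simp add: floor_eq_iff)
  then show ?thesis by (simp add: pos_def edge_def frac_def algebra_simps)
qed

lemma pos_convex_combination:
  assumes "x \<in> {of_int i..of_int i + 1}" "x' \<in> {of_int i..of_int i + 1}" "0 \<le> s" "s \<le> 1"
  shows "pos V (c, (1 - s) * x + s * x') = (1 - s) *\<^sub>R pos V (c, x) + s *\<^sub>R pos V (c, x')"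
proof -
  have "convex {of_int i..of_int i + 1::real}" by simp
  then have "(1 - s) *\<^sub>R x + s *\<^sub>R x' \<in> {of_int i..of_int i + 1}"
    using assms by (intro convexD_alt) auto
  then show ?thesis
    using assms by (simp add: pos_on_edge[of i]) (simp add: algebra_simps)
qed

lemma continuous_on_pos: "continuous_on {0..real N} (\<lambda>x. pos V (c, x))"
proof (induction N)
  case 0
  then show ?case by simp
next
  case (Suc N)
  have "continuous_on {real N..real N + 1} (\<lambda>x. vtx V c (int N) + (x - of_int (int N)) *\<^sub>R edge V c (int N))"
    by (intro continuous_intros)
  then have "continuous_on {real N..real N + 1} (\<lambda>x. pos V (c, x))"
    by (rule continuous_on_eq) (use pos_on_edge[of "int N" _ V c] in auto)
  with Suc have "continuous_on ({0..real N} \<union> {real N..real N + 1}) (\<lambda>x. pos V (c, x))"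
    by (intro continuous_on_closed_Un) auto
  moreover have "{0..real N} \<union> {real N..real N + 1} = {0..real (Suc N)}" by auto
  ultimately show ?case by simp
qed

lemma near_point_at:
  assumes "\<bar>x - x'\<bar> < e"
  shows "near V e (point_at V c x) (point_at V c x')"
  unfolding near_def point_at_shift fst_conv snd_conv
proof (intro conjI refl exI)
  let ?j = "\<lambda>x. \<lfloor>x / of_int (nverts V c)\<rfloor>"
  show "\<bar>x + of_int (- ?j x * nverts V c) - (x' + of_int (- ?j x' * nverts V c)) +
      of_int ((?j x - ?j x') * nverts V c)\<bar> < e"
    using assms by (simp add: algebra_simps)
qed

section \<open>The pairs in VB in the parameter plane\<close>

text \<open>
  The number of integers between two reals, as \<open>gap_eq_card\<close> shows. This form makes it visible that
  the number depends only on the cells of the integer grid in which the two reals lie.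
\<close>

definition gap :: "real \<Rightarrow> real \<Rightarrow> int" where
  "gap x y = max \<lfloor>x\<rfloor> \<lfloor>y\<rfloor> - min \<lceil>x\<rceil> \<lceil>y\<rceil> + 1"

lemma gap_eq_card:
  assumes "x \<le> y"
  shows "gap x y = int (card {k::int. x \<le> of_int k \<and> of_int k \<le> y})"
proof -
  have "{k::int. x \<le> of_int k \<and> of_int k \<le> y} = {\<lceil>x\<rceil>..\<lfloor>y\<rfloor>}"
    by (auto simp: ceiling_le_iff le_floor_iff)
  moreover have "\<lfloor>x\<rfloor> \<le> \<lfloor>y\<rfloor>" "\<lceil>x\<rceil> \<le> \<lceil>y\<rceil>" using assms by (auto intro: floor_mono ceiling_mono)
  moreover have "\<lceil>x\<rceil> \<le> \<lfloor>y\<rfloor> + 1" using assms by linarith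
  ultimately show ?thesis by (simp add: gap_def)
qed

lemma gap_commute: "gap x y = gap y x"
  by (simp add: gap_def max.commute min.commute)

lemma gap_shift: "gap (x + of_int m) (y + of_int m) = gap x y"
  by (simp add: gap_def)

lemma gap_mono:
  assumes "x \<le> y" "x' \<le> x" "y \<le> y'"
  shows "gap x y \<le> gap x' y'"
proof -
  have "\<lfloor>x\<rfloor> \<le> \<lfloor>y\<rfloor>" "\<lceil>x\<rceil> \<le> \<lceil>y\<rceil>" "\<lfloor>x'\<rfloor> \<le> \<lfloor>x\<rfloor>" "\<lceil>x'\<rceil> \<le> \<lceil>x\<rceil>" "\<lfloor>y\<rfloor> \<le> \<lfloor>y'\<rfloor>" "\<lceil>y\<rceil> \<le> \<lceil>y'\<rceil>"
    using assms by (auto intro: floor_mono ceiling_mono)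
  then show ?thesis by (simp add: gap_def)
qed

text \<open>
  Moving a point within its closed cell can only raise its floor and lower its ceiling, so that no
  integer is lost.
\<close>

lemma gap_cell:
  assumes "of_int \<lfloor>x\<rfloor> \<le> x'" "x' \<le> of_int \<lceil>x\<rceil>" "of_int \<lfloor>y\<rfloor> \<le> y'" "y' \<le> of_int \<lceil>y\<rceil>"
  shows "gap x y \<le> gap x' y'"
proof -
  have "\<lfloor>x\<rfloor> \<le> \<lfloor>x'\<rfloor>" "\<lceil>x'\<rceil> \<le> \<lceil>x\<rceil>" "\<lfloor>y\<rfloor> \<le> \<lfloor>y'\<rfloor>" "\<lceil>y'\<rceil> \<le> \<lceil>y\<rceil>"
    using assms by (auto simp: le_floor_iff ceiling_le_iff)
  then show ?thesis by (simp add: gap_def)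
qed

text \<open>
  All pairs of parameters, on the whole real line, that represent a pair in \<open>VB\<close>. The minimum over
  the two arcs is replaced by the minimum over all translates of the second parameter: the translates
  that do not give one of the two arcs give intervals containing one of them. In this form,
  invariance under periods is immediate.
\<close>

definition VB_lift :: "real \<Rightarrow> polygon \<Rightarrow> nat \<Rightarrow> nat \<Rightarrow> (real \<times> real) set" where
  "VB_lift l V c c' = {(x, y). c = c' \<longrightarrow>
     (\<forall>m::int. pi / theta1 l \<le> of_int (gap x (y + of_int (m * nverts V c))))}"

lemma vb_eq_gap:
  assumes "0 \<le> x" "x \<le> y" "y < of_int (nverts V c)"
  shows "vb V (c, x) (c, y) \<ge> ereal r \<longleftrightarrow>
    (\<forall>m::int. r \<le> of_int (gap x (y + of_int (m * nverts V c))))"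
proof -
  let ?n = "nverts V c"
  have n: "?n > 0" using assms by (cases "?n > 0") (auto simp: not_less of_int_nonneg)
  have 0: "real (card {k::int. x \<le> of_int k \<and> of_int k \<le> y}) = of_int (gap x y)"
    using gap_eq_card[OF assms(2)] by simp
  have "gap y (x + of_int ?n) = gap (y + of_int (- ?n)) (x + of_int ?n + of_int (- ?n))"
    by (rule gap_shift[symmetric])
  then have 2: "gap y (x + of_int ?n) = gap x (y + of_int (- 1 * ?n))"
    by (simp add: gap_commute)
  have 1: "real (card {k::int. y \<le> of_int k \<and> of_int k \<le> x + of_int ?n}) = of_int (gap x (y + of_int (- 1 * ?n)))"
    using gap_eq_card[of y "x + of_int ?n"] assms by (simp only: 2[symmetric])
  have vb: "vb V (c, x) (c, y) \<ge> ereal r \<longleftrightarrow> r \<le> of_int (gap x (y + of_int (0 * ?n))) \<and> r \<le> of_int (gap x (y + of_int (- 1 * ?n)))"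
    unfolding vb_def Let_def fst_conv snd_conv min_absorb1[OF assms(2)] max_absorb2[OF assms(2)] 0 1
    by simp
  \<comment> \<open>The shifts \<open>0\<close> and \<open>-1\<close> give the two arcs; any other shift gives an interval containing
    one of them.\<close>
  have arc: "gap x (y + of_int (0 * ?n)) \<le> gap x (y + of_int (m * ?n)) \<or>
      gap x (y + of_int (- 1 * ?n)) \<le> gap x (y + of_int (m * ?n))" for m :: int
  proof (cases "m \<ge> 0")
    case True
    then have "0 \<le> m * ?n" using n by simp
    then have "0 \<le> real_of_int (m * ?n)" by (simp only: of_int_0_le_iff)
    then have "gap x y \<le> gap x (y + of_int (m * ?n))" using assms by (intro gap_mono) auto
    then show ?thesis by simp
  next
    case False
    then have "m * ?n \<le> - 1 * ?n" using n by (intro mult_right_mono) auto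
    then have "real_of_int (m * ?n) \<le> real_of_int (- 1 * ?n)" by (simp only: of_int_le_iff)
    then have "gap (y + of_int (- 1 * ?n)) x \<le> gap (y + of_int (m * ?n)) x"
      using assms by (intro gap_mono) auto
    then show ?thesis by (simp add: gap_commute)
  qed
  have "r \<le> of_int (gap x (y + of_int (m * ?n)))"
    if "r \<le> of_int (gap x (y + of_int (0 * ?n)))" "r \<le> of_int (gap x (y + of_int (- 1 * ?n)))" for m :: int
    using arc[of m] that by (meson of_int_le_iff order_trans)
  then show ?thesis unfolding vb by blast
qed

lemma vb_commute: "vb V p q = vb V q p"
  by (simp add: vb_def Let_def min.commute max.commute)

lemma VB_lift_commute: "(y, x) \<in> VB_lift l V c c \<longleftrightarrow> (x, y) \<in> VB_lift l V c c"
proof -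
  have "gap y (x + of_int (m * nverts V c)) = gap x (y + of_int (- m * nverts V c))" for m :: int
    using gap_shift[of y "- m * nverts V c" "x + of_int (m * nverts V c)"] by (simp add: gap_commute)
  then show ?thesis
    unfolding VB_lift_def mem_Collect_eq prod.case by (metis minus_minus)
qed

lemma VB_iff_lift:
  assumes "(c, x) \<in> points V" "(c', y) \<in> points V"
  shows "((c, x), (c', y)) \<in> VB l V \<longleftrightarrow> (x, y) \<in> VB_lift l V c c'"
proof (cases "c = c'")
  case False
  then show ?thesis using assms by (simp add: VB_def vb_def VB_lift_def)
next
  case [simp]: True
  show ?thesis
  proof (cases "x \<le> y")
    case True
    then show ?thesis using assms vb_eq_gap[of x y V c "pi / theta1 l"]
      by (simp add: VB_def VB_lift_def points_def)
  next
    case False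
    then show ?thesis using assms vb_eq_gap[of y x V c "pi / theta1 l"]
        VB_lift_commute[of y x l V c] vb_commute[of V "(c, x)" "(c, y)"]
      by (simp add: VB_def VB_lift_def points_def)
  qed
qed

lemma VB_lift_shift:
  "(x + of_int (j * nverts V c), y + of_int (j' * nverts V c')) \<in> VB_lift l V c c' \<longleftrightarrow>
   (x, y) \<in> VB_lift l V c c'"
proof (cases "c = c'")
  case [simp]: True
  let ?n = "nverts V c"
  have *: "gap (x + of_int (j * ?n)) (y + of_int (j' * ?n) + of_int (m * ?n)) =
      gap x (y + of_int ((m + j' - j) * ?n))" for m
    using gap_shift[of x "j * ?n" "y + of_int ((m + j' - j) * ?n)"] by (simp add: algebra_simps)
  have "(\<forall>m. P (m + j' - j)) \<longleftrightarrow> (\<forall>m. P m)" for P :: "int \<Rightarrow> bool"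
    by (metis add_diff_cancel diff_add_cancel)
  from this[of "\<lambda>m. pi / theta1 l \<le> of_int (gap x (y + of_int (m * ?n)))"]
  show ?thesis unfolding VB_lift_def mem_Collect_eq prod.case True[symmetric] * by simp
qed (simp add: VB_lift_def)

lemma point_at_VB_iff:
  assumes "closed_polygon V" "c < length V" "c' < length V"
  shows "(point_at V c x, point_at V c' y) \<in> VB l V \<longleftrightarrow> (x, y) \<in> VB_lift l V c c'"
  using point_at_in_points[OF assms(1,2), of x] point_at_in_points[OF assms(1,3), of y]
  unfolding point_at_shift by (simp only: VB_iff_lift VB_lift_shift)

lemma VB_lift_cell:
  assumes "(x, y) \<in> VB_lift l V c c'"
    and "of_int \<lfloor>x\<rfloor> \<le> x'" "x' \<le> of_int \<lceil>x\<rceil>" "of_int \<lfloor>y\<rfloor> \<le> y'" "y' \<le> of_int \<lceil>y\<rceil>"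
  shows "(x', y') \<in> VB_lift l V c c'"
proof -
  have "gap x (y + of_int m) \<le> gap x' (y' + of_int m)" for m :: int
    using assms by (intro gap_cell) auto
  then have "real_of_int (gap x (y + of_int m)) \<le> of_int (gap x' (y' + of_int m))" for m :: int
    by simp
  then show ?thesis using assms(1)
    unfolding VB_lift_def mem_Collect_eq prod.case using order_trans by blast
qed

lemma eventually_in_cell:
  fixes x0 :: real
  shows "eventually (\<lambda>x. of_int \<lfloor>x\<rfloor> \<le> x0 \<and> x0 \<le> of_int \<lceil>x\<rceil>) (nhds x0)"
proof -
  have "eventually (\<lambda>x. x \<in> {of_int (\<lceil>x0\<rceil> - 1)<..<of_int (\<lfloor>x0\<rfloor> + 1)}) (nhds x0)"
    by (intro eventually_nhds_in_open) (auto, linarith+)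
  then show ?thesis
  proof eventually_elim
    case (elim x)
    then have "\<lfloor>x\<rfloor> \<le> \<lfloor>x0\<rfloor>" "\<lceil>x0\<rceil> \<le> \<lceil>x\<rceil>" by (auto; linarith)+
    then show ?case by (simp add: le_floor_iff ceiling_le_iff)
  qed
qed

text \<open>
  A limit point of the set lies in the closed cell of each sufficiently close point of the set.
\<close>

lemma closed_VB_lift: "closed (VB_lift l V c c')"
proof -
  have "z0 \<in> VB_lift l V c c'" if "z0 \<in> closure (VB_lift l V c c')" for z0
  proof -
    obtain x0 y0 where z0: "z0 = (x0, y0)" by fastforce
    have "eventually (\<lambda>z. (of_int \<lfloor>fst z\<rfloor> \<le> x0 \<and> x0 \<le> of_int \<lceil>fst z\<rceil>) \<and>
        (of_int \<lfloor>snd z\<rfloor> \<le> y0 \<and> y0 \<le> of_int \<lceil>snd z\<rceil>)) (nhds z0)"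
      unfolding z0
      by (intro eventually_conj eventually_compose_filterlim[OF eventually_in_cell[of x0]]
          eventually_compose_filterlim[OF eventually_in_cell[of y0]])
        (auto simp: nhds_prod filterlim_fst filterlim_snd)
    then obtain U where U: "open U" "z0 \<in> U" "\<And>z. z \<in> U \<Longrightarrow> (of_int \<lfloor>fst z\<rfloor> \<le> x0 \<and> x0 \<le> of_int \<lceil>fst z\<rceil>) \<and>
        (of_int \<lfloor>snd z\<rfloor> \<le> y0 \<and> y0 \<le> of_int \<lceil>snd z\<rceil>)"
      unfolding eventually_nhds by blast
    from U(1,2) that obtain z where "z \<in> U" "z \<in> VB_lift l V c c'"
      by (meson closure_iff_nhds_not_empty order_refl disjoint_iff)
    then show ?thesis using U(3)[of z] VB_lift_cell[of "fst z" "snd z"] by (simp add: z0)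
  qed
  then show ?thesis by (metis closure_closed closure_subset subsetI subset_antisym closed_closure)
qed

text \<open>
  Sufficiently close points lie on a common edge: they have parameters \<open>x\<close> and \<open>x'\<close> in a common
  closed unit interval, and \<open>x\<close> lies in the closed cell of \<open>x'\<close>. The last fact allows to move from
  \<open>x'\<close> to \<open>x\<close> within the closed cells that make up \<open>VB\<close>.
\<close>

lemma near_lift:
  assumes closed: "closed_polygon V" and p: "p \<in> points V"
  obtains e where "e > 0" "\<And>p'. p' \<in> points V \<Longrightarrow> near V e p p' \<Longrightarrow>
    \<exists>i x x'. is_vertex V (fst p) i \<and> x \<in> {of_int i..of_int i + 1} \<and> x' \<in> {of_int i..of_int i + 1} \<and>
      point_at V (fst p) x = p \<and> point_at V (fst p) x' = p' \<and> of_int \<lfloor>x'\<rfloor> \<le> x \<and> x \<le> of_int \<lceil>x'\<rceil>"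
proof -
  obtain c x0 where p_eq: "p = (c, x0)" by fastforce
  have c: "c < length V" using p by (simp add: p_eq points_def)
  let ?n = "nverts V c"
  have n: "?n > 0" by (rule nverts_pos[OF closed c])
  obtain e where e: "e > 0"
    "\<And>x. dist x x0 < e \<Longrightarrow> of_int \<lfloor>x\<rfloor> \<le> x0 \<and> x0 \<le> of_int \<lceil>x\<rceil>"
    using eventually_in_cell[of x0] unfolding eventually_nhds_metric by blast
  show thesis
  proof (rule that[OF e(1)])
    fix p' assume p': "p' \<in> points V" and "near V e p p'"
    then obtain x0' j where p'_eq: "p' = (c, x0')" and j: "\<bar>x0 - x0' + of_int (j * ?n)\<bar> < e"
      by (cases p') (auto simp: near_def p_eq)
    define x1 where "x1 = x0' - of_int (j * ?n)"
    have "dist x1 x0 < e" using j by (simp add: x1_def dist_real_def abs_minus_commute algebra_simps)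
    then have cell: "of_int \<lfloor>x1\<rfloor> \<le> x0 \<and> x0 \<le> of_int \<lceil>x1\<rceil>" by (rule e(2))
    \<comment> \<open>Shift by a period so that the edge containing both parameters gets a standard index.\<close>
    define k where "k = - (\<lfloor>x1\<rfloor> div ?n)"
    have i: "\<lfloor>x1\<rfloor> + k * ?n = \<lfloor>x1\<rfloor> mod ?n" by (simp add: k_def minus_div_mult_eq_mod)
    have floor: "\<lfloor>x1 + of_int (k * ?n)\<rfloor> = \<lfloor>x1\<rfloor> + k * ?n"
      and ceil: "\<lceil>x1 + of_int (k * ?n)\<rceil> = \<lceil>x1\<rceil> + k * ?n"
      by (rule floor_add_int[symmetric], rule ceiling_add_of_int)
    have "point_at V c (x1 + of_int (k * ?n)) = p'"
      using point_at_eqI[of c x0' V "k - j"] p' by (simp add: p'_eq x1_def algebra_simps)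
    moreover have "point_at V c (x0 + of_int (k * ?n)) = p"
      using point_at_eqI[of c x0 V k] p by (simp add: p_eq)
    moreover have "is_vertex V c (\<lfloor>x1\<rfloor> + k * ?n)"
      unfolding i using c n by (simp add: is_vertex_def)
    moreover have "of_int \<lceil>x1\<rceil> \<le> real_of_int \<lfloor>x1\<rfloor> + 1" using ceiling_diff_floor_le_1[of x1] by linarith
    ultimately show "\<exists>i x x'. is_vertex V (fst p) i \<and> x \<in> {of_int i..of_int i + 1} \<and>
      x' \<in> {of_int i..of_int i + 1} \<and> point_at V (fst p) x = p \<and> point_at V (fst p) x' = p' \<and>
      of_int \<lfloor>x'\<rfloor> \<le> x \<and> x \<le> of_int \<lceil>x'\<rceil>"
      unfolding p_eq fst_conv using cell floor ceil
      by (intro exI[of _ "\<lfloor>x1\<rfloor> + k * ?n"] exI[of _ "x0 + of_int (k * ?n)"] exI[of _ "x1 + of_int (k * ?n)"] conjI)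
        (auto; linarith)+
  qed
qed

section \<open>Turning angles and radii\<close>

lemma cosine_bounds:
  fixes a b :: "'a::real_inner"
  shows "a \<bullet> b / (norm a * norm b) \<in> {-1..1}"
proof (cases "a = 0 \<or> b = 0")
  case False
  then have pos: "norm a * norm b > 0" by simp
  moreover have "\<bar>a \<bullet> b\<bar> \<le> norm a * norm b" by (rule Cauchy_Schwarz_ineq2)
  ultimately have "\<bar>a \<bullet> b / (norm a * norm b)\<bar> \<le> 1" by (simp add: abs_divide)
  then show ?thesis unfolding abs_le_iff by simp
qed auto

lemma turn_range: "turn V c k \<in> {0..pi}"
  using cosine_bounds[of "edge V c (k - 1)" "edge V c k"]
  by (simp add: turn_def arccos_lbound arccos_ubound)

lemma min_rad_side_nonneg: "0 \<le> min_rad_side s V c k"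
proof -
  have "0 \<le> tan (turn V c k / 2)"
  proof (cases "turn V c k = pi")
    case False
    then have "0 \<le> turn V c k / 2" "turn V c k / 2 < pi / 2" using turn_range[of V c k] by auto
    then show ?thesis by (meson le_less tan_zero tan_gt_zero tan_pos_pi2_le)
  qed (simp add: tan_def)
  then show ?thesis by (simp add: min_rad_side_def)
qed

text \<open>
  The infimum that defines thickness is over a nonempty set: without bends all edges of a component
  would point in the same direction, and could not add up to zero.
\<close>

lemma exists_bent_vertex:
  assumes closed: "closed_polygon V" and c: "c < length V"
  shows "\<exists>k. is_vertex V c k \<and> turn V c k \<noteq> 0"
proof (rule ccontr)
  let ?n = "nverts V c" and ?e = "edge V c"
  assume "\<not> ?thesis"
  then have straight: "turn V c k = 0" if "0 \<le> k" "k < ?n" for k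
    using that c by (auto simp: is_vertex_def)
  have same_direction: "norm (?e (k - 1)) *\<^sub>R ?e k = norm (?e k) *\<^sub>R ?e (k - 1)" if "0 \<le> k" "k < ?n" for k
  proof -
    have "cos (turn V c k) = ?e (k - 1) \<bullet> ?e k / (norm (?e (k - 1)) * norm (?e k))"
      using cosine_bounds[of "?e (k - 1)" "?e k"] by (simp add: turn_def cos_arccos)
    then have "?e (k - 1) \<bullet> ?e k = norm (?e (k - 1)) * norm (?e k)"
      using straight[OF that] edge_nonzero[OF closed c, of k] edge_nonzero[OF closed c, of "k - 1"]
      by (simp add: field_simps)
    then show ?thesis by (simp add: norm_cauchy_schwarz_eq)
  qed
  have "\<exists>r>0. ?e (int m) = r *\<^sub>R ?e 0" if "m < nat ?n" for m
    using that
  proof (induction m)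
    case 0
    then show ?case by (intro exI[of _ 1]) simp
  next
    case (Suc m)
    then obtain r where r: "r > 0" "?e (int m) = r *\<^sub>R ?e 0" by auto
    have pos: "norm (?e (int m)) > 0" "norm (?e (int (Suc m))) > 0"
      using edge_nonzero[OF closed c] by simp_all
    have "norm (?e (int m)) *\<^sub>R ?e (int (Suc m)) = norm (?e (int (Suc m))) *\<^sub>R ?e (int m)"
      using same_direction[of "int (Suc m)"] Suc.prems by simp
    then have "(1 / norm (?e (int m))) *\<^sub>R norm (?e (int m)) *\<^sub>R ?e (int (Suc m)) =
        (1 / norm (?e (int m))) *\<^sub>R norm (?e (int (Suc m))) *\<^sub>R ?e (int m)"
      by (rule arg_cong)
    then have "?e (int (Suc m)) = (1 / norm (?e (int m)) * norm (?e (int (Suc m)))) *\<^sub>R ?e (int m)"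
      using pos(1) by (simp only: scaleR_scaleR) simp
    then have "?e (int (Suc m)) = (norm (?e (int (Suc m))) * r / norm (?e (int m))) *\<^sub>R ?e 0"
      by (simp only: r(2) scaleR_scaleR) (simp add: mult.commute)
    moreover have "0 < norm (?e (int (Suc m))) * r / norm (?e (int m))"
      using pos r(1) by simp
    ultimately show ?case by blast
  qed
  then have "?e (int m) \<bullet> ?e 0 > 0" if "m < nat ?n" for m
    using that edge_nonzero[OF closed c, of 0] by fastforce
  then have "0 < (\<Sum>m<nat ?n. ?e (int m) \<bullet> ?e 0)"
    using nverts_pos[OF closed c] by (intro sum_pos) (auto simp: lessThan_empty_iff)
  also have "\<dots> = (\<Sum>m<nat ?n. vtx V c (int (Suc m)) - vtx V c (int m)) \<bullet> ?e 0"
    by (simp add: inner_sum_left edge_def add.commute)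
  also have "\<dots> = (vtx V c (int (nat ?n)) - vtx V c (int 0)) \<bullet> ?e 0"
    by (simp only: sum_lessThan_telescope[of "\<lambda>m. vtx V c (int m)"])
  also have "\<dots> = 0" using nverts_pos[OF closed c] by (simp add: vtx_def)
  finally show False by simp
qed

locale polygon_variation =
  fixes V W :: polygon
  assumes closed: "closed_polygon V" and lengths: "map length W = map length V"
begin

lemma length_W: "length W = length V"
  using lengths by (metis length_map)

lemma length_component: "c < length V \<Longrightarrow> length (W ! c) = length (V ! c)"
  using lengths length_W by (metis nth_map)

lemma length_vary [simp]: "length (vary V W t) = length V"
  by (simp add: vary_def length_W)

lemma nverts_vary [simp]: "c < length V \<Longrightarrow> nverts (vary V W t) c = nverts V c"
  by (simp add: vary_def nverts_def length_W length_component)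

lemma vary_zero [simp]: "vary V W 0 = V"
  by (auto simp: vary_def length_W length_component intro!: nth_equalityI)

lemma vtx_vary: "c < length V \<Longrightarrow> vtx (vary V W t) c k = vtx V c k + t *\<^sub>R vtx W c k"
proof -
  assume c: "c < length V"
  let ?n = "nverts V c"
  have "nat (k mod ?n) < length (V ! c)"
    using nverts_pos[OF closed c] by (simp add: nverts_def nat_less_iff)
  moreover have "nverts W c = ?n" using c by (simp add: nverts_def length_component)
  ultimately show ?thesis
    using c by (simp add: vtx_def) (simp add: vary_def length_W length_component)
qed

lemma edge_vary: "c < length V \<Longrightarrow> edge (vary V W t) c k = edge V c k + t *\<^sub>R edge W c k"
  by (simp add: edge_def vtx_vary algebra_simps)

lemma pos_vary: "fst p < length V \<Longrightarrow> pos (vary V W t) p = pos V p + t *\<^sub>R pos W p"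
  by (cases p) (simp add: pos_def vtx_vary algebra_simps)

lemma is_vertex_vary [simp]: "is_vertex (vary V W t) c k \<longleftrightarrow> is_vertex V c k"
  by (auto simp: is_vertex_def)

lemma VB_vary [simp]: "VB l (vary V W t) = VB l V"
proof -
  have "points (vary V W t) = points V" by (auto simp: points_def)
  moreover have "vb (vary V W t) p q = vb V p q" if "p \<in> points V" for p q
    using that by (auto simp: vb_def points_def Let_def)
  ultimately show ?thesis by (auto simp: VB_def)
qed

lemma finite_vertices: "finite {(c, k). is_vertex V c k}"
proof -
  have "{(c, k). is_vertex V c k} = (SIGMA c:{..<length V}. {0..<nverts V c})"
    by (auto simp: is_vertex_def)
  then show ?thesis by simp
qed

context
  fixes c :: nat and k :: int
  assumes c: "c < length V"
begin

lemma norm_edge_vary_differentiable: "(\<lambda>t. norm (edge (vary V W t) c j)) differentiable (at 0)"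
proof -
  have "(\<lambda>t. edge V c j + t *\<^sub>R edge W c j) differentiable (at 0)"
    by (intro derivative_intros)
  then show ?thesis
    using edge_nonzero[OF closed c, of j]
    by (simp add: edge_vary[OF c] differentiable_compose[of norm])
qed

lemma cosine_vary_differentiable:
  "(\<lambda>t. edge (vary V W t) c (k - 1) \<bullet> edge (vary V W t) c k /
     (norm (edge (vary V W t) c (k - 1)) * norm (edge (vary V W t) c k))) differentiable (at 0)"
proof -
  have "(\<lambda>t. edge (vary V W t) c j) differentiable (at 0)" for j
    unfolding edge_vary[OF c] by (intro derivative_intros)
  then show ?thesis
    using norm_edge_vary_differentiable edge_nonzero[OF closed c]
    by (intro differentiable_divide differentiable_inner differentiable_mult)
      (auto simp: edge_vary[OF c])
qed

lemma turn_vary_tendsto: "((\<lambda>t. turn (vary V W t) c k) \<longlongrightarrow> turn V c k) (at_right 0)"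
proof -
  have "((\<lambda>t. edge (vary V W t) c (k - 1) \<bullet> edge (vary V W t) c k /
     (norm (edge (vary V W t) c (k - 1)) * norm (edge (vary V W t) c k))) \<longlongrightarrow>
     edge V c (k - 1) \<bullet> edge V c k / (norm (edge V c (k - 1)) * norm (edge V c k))) (at_right 0)"
    using differentiable_imp_continuous_within[OF cosine_vary_differentiable]
    by (auto simp: continuous_within edge_vary[OF c] intro: tendsto_within_subset)
  then show ?thesis unfolding turn_def
    using cosine_bounds by (intro continuous_on_tendsto_compose[OF continuous_on_arccos']) auto
qed

lemma norm_edge_vary_tendsto:
  "((\<lambda>t. norm (edge (vary V W t) c j)) \<longlongrightarrow> norm (edge V c j)) (at_right 0)"
  using differentiable_imp_continuous_within[OF norm_edge_vary_differentiable, of j]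
  by (auto simp: continuous_within edge_vary[OF c] intro: tendsto_within_subset)

lemma min_rad_side_vary_differentiable:
  assumes "0 < turn V c k" "turn V c k < pi"
  shows "(\<lambda>t. min_rad_side s (vary V W t) c k) differentiable (at 0)"
proof -
  define C where "C t = edge (vary V W t) c (k - 1) \<bullet> edge (vary V W t) c k /
     (norm (edge (vary V W t) c (k - 1)) * norm (edge (vary V W t) c k))" for t
  have turn: "turn (vary V W t) c k = arccos (C t)" for t
    by (simp add: turn_def C_def)
  have C: "C differentiable (at 0)"
    unfolding C_def by (rule cosine_vary_differentiable)
  have turn0: "arccos (C 0) = turn V c k"
    by (simp add: turn_def C_def edge_vary[OF c])
  have "C 0 \<in> {-1..1}" unfolding C_def by (rule cosine_bounds)
  moreover have "C 0 \<noteq> 1" "C 0 \<noteq> - 1" using assms turn0 by auto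
  ultimately have "arccos differentiable (at (C 0))"
    using DERIV_arccos[of "C 0"] by (auto simp: real_differentiable_def)
  then have half: "(\<lambda>t. arccos (C t) / 2) differentiable (at 0)"
    by (intro derivative_intros differentiable_compose[OF _ C]) auto
  have pos: "cos (arccos (C 0) / 2) \<noteq> 0" "tan (arccos (C 0) / 2) \<noteq> 0"
    using assms cos_gt_zero[of "turn V c k / 2"] tan_gt_zero[of "turn V c k / 2"]
    by (auto simp: turn0)
  have "tan differentiable (at (arccos (C 0) / 2))"
    unfolding real_differentiable_def using DERIV_tan[OF pos(1)] by blast
  then have tan: "(\<lambda>t. tan (arccos (C t) / 2)) differentiable (at 0)"
    by (rule differentiable_compose[of tan "\<lambda>t. arccos (C t) / 2", OF _ half])
  have "2 * tan (arccos (C 0) / 2) \<noteq> 0" using pos(2) by simp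
  then have "(\<lambda>t. norm (edge (vary V W t) c j) / (2 * tan (arccos (C t) / 2))) differentiable (at 0)" for j
    by (rule differentiable_divide[OF norm_edge_vary_differentiable differentiable_mult[OF differentiable_const tan]])
  then show ?thesis
    by (cases s) (simp_all add: min_rad_side_def turn)
qed

text \<open>
  A vertex that starts to bend enters the infimum with a radius that tends to infinity, so it does not
  affect the thickness for small \<open>t\<close>.
\<close>

lemma min_rad_side_vary_straight:
  assumes "turn V c k = 0"
  shows "eventually (\<lambda>t. turn (vary V W t) c k \<noteq> 0 \<longrightarrow> 2 \<le> min_rad_side s (vary V W t) c k) (at_right 0)"
proof -
  let ?j = "case s of Minus \<Rightarrow> k - 1 | Plus \<Rightarrow> k"
  let ?T = "\<lambda>t. turn (vary V W t) c k"
  have lim: "(?T \<longlongrightarrow> 0) (at_right 0)" using turn_vary_tendsto assms by simp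
  \<comment> \<open>The radius is at least \<open>2\<close> as soon as the edge is at least \<open>4 tan (T / 2)\<close> long.\<close>
  have "((\<lambda>t. 4 * tan (?T t / 2)) \<longlongrightarrow> 4 * tan (0 / 2)) (at_right 0)"
    by (intro tendsto_intros lim) auto
  then have "((\<lambda>t. norm (edge (vary V W t) c ?j) - 4 * tan (?T t / 2)) \<longlongrightarrow> norm (edge V c ?j) - 4 * tan (0 / 2)) (at_right 0)"
    by (intro tendsto_diff norm_edge_vary_tendsto)
  then have "eventually (\<lambda>t. 0 < norm (edge (vary V W t) c ?j) - 4 * tan (?T t / 2)) (at_right 0)"
    using edge_nonzero[OF closed c] by (intro order_tendstoD(1)) auto
  moreover have "eventually (\<lambda>t. ?T t < pi) (at_right 0)"
    using lim by (intro order_tendstoD(2)) auto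
  ultimately show ?thesis
  proof eventually_elim
    case (elim t)
    show ?case
    proof
      assume "?T t \<noteq> 0"
      then have "0 < ?T t" using turn_range[of "vary V W t" c k] by auto
      then have "0 < tan (?T t / 2)" using elim by (intro tan_gt_zero) auto
      then have "2 \<le> norm (edge (vary V W t) c ?j) / (2 * tan (?T t / 2))"
        using elim by (simp add: field_simps)
      then show "2 \<le> min_rad_side s (vary V W t) c k"
        by (cases s) (simp_all add: min_rad_side_def)
    qed
  qed
qed

end

end

section \<open>Distances of the pairs in VB\<close>

locale thick_polygon_variation = polygon_variation +
  fixes l :: real
  assumes thick: "CThi l V = 1"
begin

text \<open>
  The first variation of half the distance of two points.
\<close>

definition slope :: "point \<Rightarrow> point \<Rightarrow> real" where
  "slope p q = (pos W p - pos W q) \<bullet> (pos V p - pos V q) / (2 * d V p q)"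

definition contacts :: "(point \<times> point) set" where
  "contacts = {(p, q). (p, q) \<in> VB l V \<and> d V p q = 2}"

lemma bdd_below_clearances:
  "bdd_below ({min_rad U c k | c k. is_vertex U c k \<and> turn U c k \<noteq> 0} \<union>
     {d U p q / 2 | p q. (p, q) \<in> VB l U})"
proof -
  have "0 \<le> min_rad U c k" for c k by (simp add: min_rad_def min_rad_side_nonneg)
  moreover have "0 \<le> d U p q / 2" for p q by (simp add: d_def)
  ultimately show ?thesis by (intro bdd_belowI[of _ 0]) blast
qed

lemma VB_distance: "(p, q) \<in> VB l V \<Longrightarrow> 2 \<le> d V p q"
  using cInf_lower[OF _ bdd_below_clearances, of "d V p q / 2" V] thick
  by (fastforce simp: CThi_def)

lemma bent_min_rad_side: "is_vertex V c k \<Longrightarrow> turn V c k \<noteq> 0 \<Longrightarrow> 1 \<le> min_rad_side s V c k"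
  using cInf_lower[OF _ bdd_below_clearances, of "min_rad V c k" V] thick
  by (cases s) (fastforce simp: CThi_def min_rad_def)+

text \<open>
  At the turning angle \<open>\<pi>\<close> the value of \<open>tan (pi / 2)\<close> is a quotient by zero, so the radius has the
  default value \<open>0\<close>, which is too small for a polygon of thickness \<open>1\<close>. So radii are differentiable at all vertices that bend.
\<close>

lemma bent_turn:
  assumes "is_vertex V c k" "turn V c k \<noteq> 0"
  shows "0 < turn V c k" "turn V c k < pi"
proof -
  have "turn V c k \<noteq> pi"
  proof
    assume "turn V c k = pi"
    then have "min_rad_side Plus V c k = 0" by (simp add: min_rad_side_def tan_def)
    then show False using bent_min_rad_side[OF assms, of Plus] by simp
  qed
  then show "0 < turn V c k" "turn V c k < pi" using turn_range[of V c k] assms(2) by auto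
qed

lemma VB_points: "(p, q) \<in> VB l V \<Longrightarrow> p \<in> points V \<and> q \<in> points V"
  by (simp add: VB_def)

lemma points_component: "p \<in> points V \<Longrightarrow> fst p < length V"
  by (auto simp: points_def)

lemma d_vary:
  assumes "(p, q) \<in> VB l V"
  shows "d (vary V W t) p q = norm ((pos V p - pos V q) + t *\<^sub>R (pos W p - pos W q))"
  using points_component VB_points[OF assms] by (simp add: d_def dist_norm pos_vary algebra_simps)

lemma d_vary_lower_bound:
  assumes "(p, q) \<in> VB l V"
  shows "d V p q / 2 + t * slope p q \<le> d (vary V W t) p q / 2"
proof -
  have "pos V p - pos V q \<noteq> 0" using VB_distance[OF assms] by (auto simp: d_def)
  note bound = norm_line_lower_bound[OF this, of t "pos W p - pos W q"]
  have slope: "slope p q = (pos W p - pos W q) \<bullet> (pos V p - pos V q) / norm (pos V p - pos V q) / 2"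
    by (simp add: slope_def d_def dist_norm mult.commute)
  have "d V p q = norm (pos V p - pos V q)" by (simp add: d_def dist_norm)
  then show ?thesis using bound unfolding d_vary[OF assms] slope by simp
qed

lemma d_vary_has_derivative:
  assumes "(p, q) \<in> VB l V"
  shows "((\<lambda>t. d (vary V W t) p q / 2) has_vector_derivative slope p q) (at_right 0)"
proof -
  have "pos V p - pos V q \<noteq> 0" using VB_distance[OF assms] by (auto simp: d_def)
  from has_vector_derivative_divide[OF norm_line_has_vector_derivative[OF this, of "pos W p - pos W q"], of 2]
  show ?thesis
    unfolding d_vary[OF assms] by (simp add: slope_def d_def dist_norm field_simps)
qed

text \<open>
  One period of the lifted set, with the closing parameter included to make it compact.
\<close>

definition VB_window :: "nat \<Rightarrow> nat \<Rightarrow> (real \<times> real) set" where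
  "VB_window c c' = VB_lift l V c c' \<inter> ({0..of_int (nverts V c)} \<times> {0..of_int (nverts V c')})"

lemma compact_VB_window: "compact (VB_window c c')"
  unfolding VB_window_def by (intro closed_Int_compact closed_VB_lift compact_Times compact_Icc)

lemma VB_window_point_at:
  assumes "c < length V" "c' < length V" "(x, y) \<in> VB_window c c'"
  shows "(point_at V c x, point_at V c' y) \<in> VB l V"
  using assms by (simp add: point_at_VB_iff[OF closed] VB_window_def)

lemma VB_in_window:
  assumes "((c, x), (c', y)) \<in> VB l V"
  shows "c < length V" "c' < length V" "(x, y) \<in> VB_window c c'"
  using VB_points[OF assms] assms VB_iff_lift[of c x V c' y l]
  by (auto simp: VB_window_def points_def)

lemma continuous_on_window_pos:
  assumes "c < length V" "c' < length V"
  shows "continuous_on (VB_window c c') (\<lambda>z. pos U (c, fst z) - pos U (c', snd z))"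
proof -
  have *: "continuous_on {0..of_int (nverts V b)} (\<lambda>x. pos U (b, x))" if "b < length V" for b
    using continuous_on_pos[of "nat (nverts V b)" U b] nverts_pos[OF closed that] by simp
  show ?thesis
    by (intro continuous_on_diff continuous_on_compose2[OF *[OF assms(1)]] continuous_on_compose2[OF *[OF assms(2)]]
        continuous_on_fst continuous_on_snd continuous_on_id)
      (auto simp: VB_window_def)
qed

lemma slope_point_at:
  assumes "c < length V" "c' < length V"
  shows "slope (point_at V c x) (point_at V c' y) = slope (c, x) (c', y)"
proof -
  have "point_at V b z = point_at W b z" if "b < length V" for b z
    using that by (simp add: point_at_def nverts_def length_component)
  then have "pos W (point_at V b z) = pos W (b, z)" if "b < length V" for b z
    using that by (simp add: pos_point_at)
  then show ?thesis using assms by (simp add: slope_def d_point_at pos_point_at)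
qed

lemma
  assumes c: "c < length V" "c' < length V"
  shows continuous_on_window_d: "continuous_on (VB_window c c') (\<lambda>z. d V (c, fst z) (c', snd z) / 2)"
    and continuous_on_window_slope: "continuous_on (VB_window c c') (\<lambda>z. slope (c, fst z) (c', snd z))"
proof -
  note VW = continuous_on_window_pos[OF c, of V] continuous_on_window_pos[OF c, of W]
  have d: "d V (c, fst z) (c', snd z) \<noteq> 0" if "z \<in> VB_window c c'" for z
    using VB_distance[OF VB_window_point_at[OF c, of "fst z" "snd z"]] that by (auto simp: d_point_at)
  show "continuous_on (VB_window c c') (\<lambda>z. d V (c, fst z) (c', snd z) / 2)"
    unfolding d_def dist_norm
    by (intro continuous_on_divide continuous_on_norm VW continuous_on_const) auto
  show "continuous_on (VB_window c c') (\<lambda>z. slope (c, fst z) (c', snd z))"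
    unfolding slope_def using d unfolding d_def dist_norm
    by (intro continuous_on_divide continuous_on_inner continuous_on_mult continuous_on_norm VW
        continuous_on_const) auto
qed

lemma VB_eventually_lower_bound:
  assumes "\<And>p q. (p, q) \<in> contacts \<Longrightarrow> m \<le> slope p q" and "e > 0"
  shows "eventually (\<lambda>t. \<forall>(p, q) \<in> VB l V. 1 + t * (m - e) \<le> d (vary V W t) p q / 2) (at_right 0)"
proof -
  have "eventually (\<lambda>t. \<forall>z\<in>VB_window c c'. 1 + t * (m - e) \<le>
      d V (c, fst z) (c', snd z) / 2 + t * slope (c, fst z) (c', snd z)) (at_right 0)"
    if c: "c < length V" "c' < length V" for c c'
  proof (rule compact_linear_lower_bound[OF compact_VB_window continuous_on_window_d[OF c]
        continuous_on_window_slope[OF c] _ _ \<open>e > 0\<close>])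
    fix z assume z: "z \<in> VB_window c c'"
    then have VB: "(point_at V c (fst z), point_at V c' (snd z)) \<in> VB l V"
      by (intro VB_window_point_at c) simp
    show "1 \<le> d V (c, fst z) (c', snd z) / 2"
      using VB_distance[OF VB] by (simp add: d_point_at)
    assume "d V (c, fst z) (c', snd z) / 2 = 1"
    then have "(point_at V c (fst z), point_at V c' (snd z)) \<in> contacts"
      using VB by (simp add: contacts_def d_point_at)
    from assms(1)[OF this] show "m \<le> slope (c, fst z) (c', snd z)"
      by (simp add: slope_point_at[OF c])
  qed
  then have "eventually (\<lambda>t. \<forall>c\<in>{..<length V}. \<forall>c'\<in>{..<length V}. \<forall>z\<in>VB_window c c'. 1 + t * (m - e) \<le>
      d V (c, fst z) (c', snd z) / 2 + t * slope (c, fst z) (c', snd z)) (at_right 0)"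
    by (simp add: eventually_ball_finite_distrib)
  then show ?thesis
  proof eventually_elim
    case (elim t)
    show ?case
    proof clarify
      fix c x c' y assume VB: "((c, x), (c', y)) \<in> VB l V"
      have "1 + t * (m - e) \<le> d V (c, x) (c', y) / 2 + t * slope (c, x) (c', y)"
        using elim VB_in_window[OF VB] by fastforce
      also have "\<dots> \<le> d (vary V W t) (c, x) (c', y) / 2"
        by (rule d_vary_lower_bound[OF VB])
      finally show "1 + t * (m - e) \<le> d (vary V W t) (c, x) (c', y) / 2" .
    qed
  qed
qed

text \<open>
  Transfers compactness from the windows of the finitely many pairs of components to sets of values
  indexed by \<open>VB\<close>.
\<close>

lemma window_union:
  fixes f :: "point \<Rightarrow> point \<Rightarrow> real"
  assumes f: "\<And>c c' x y. c < length V \<Longrightarrow> c' < length V \<Longrightarrow> f (point_at V c x) (point_at V c' y) = f (c, x) (c', y)"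
    and P: "\<And>c c' x y. c < length V \<Longrightarrow> c' < length V \<Longrightarrow> P (point_at V c x) (point_at V c' y) \<longleftrightarrow> P (c, x) (c', y)"
  shows "{f p q | p q. (p, q) \<in> VB l V \<and> P p q} =
    (\<Union>c<length V. \<Union>c'<length V.
      (\<lambda>z. f (c, fst z) (c', snd z)) ` {z \<in> VB_window c c'. P (c, fst z) (c', snd z)})" (is "?L = ?R")
proof (intro set_eqI iffI)
  fix r assume "r \<in> ?L"
  then obtain c x c' y where VB: "((c, x), (c', y)) \<in> VB l V" and r: "P (c, x) (c', y)" "r = f (c, x) (c', y)" by auto
  show "r \<in> ?R"
    using VB_in_window[OF VB] r by (intro UN_I[of c] UN_I[of c'] image_eqI[of _ _ "(x, y)"]) auto
next
  fix r assume "r \<in> ?R"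
  then obtain c c' z where c: "c < length V" "c' < length V" and z: "z \<in> VB_window c c'"
    and r: "P (c, fst z) (c', snd z)" "r = f (c, fst z) (c', snd z)" by auto
  have "(point_at V c (fst z), point_at V c' (snd z)) \<in> VB l V"
    using z by (intro VB_window_point_at c) simp
  moreover have "P (point_at V c (fst z)) (point_at V c' (snd z))" using P[OF c] r(1) by simp
  moreover have "r = f (point_at V c (fst z)) (point_at V c' (snd z))" using f[OF c] r(2) by simp
  ultimately show "r \<in> ?L" by blast
qed

lemma compact_VB_distances: "compact {d V p q / 2 | p q. (p, q) \<in> VB l V}"
proof -
  have "compact (\<Union>c<length V. \<Union>c'<length V.
      (\<lambda>z. d V (c, fst z) (c', snd z) / 2) ` {z \<in> VB_window c c'. True})"
    by (intro compact_UN finite_lessThan compact_continuous_image)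
      (simp_all add: continuous_on_window_d compact_VB_window)
  then show ?thesis
    using window_union[of "\<lambda>p q. d V p q / 2" "\<lambda>p q. True"] by (simp add: d_point_at)
qed

lemma compact_contact_slopes: "compact {slope p q | p q. (p, q) \<in> contacts}"
proof -
  have "compact (\<Union>c<length V. \<Union>c'<length V. (\<lambda>z. slope (c, fst z) (c', snd z)) `
        {z \<in> VB_window c c'. d V (c, fst z) (c', snd z) / 2 = 1})"
  proof (intro compact_UN finite_lessThan)
    fix c c' assume "c \<in> {..<length V}" "c' \<in> {..<length V}"
    then have c: "c < length V" "c' < length V" by auto
    let ?A = "{z \<in> VB_window c c'. d V (c, fst z) (c', snd z) / 2 = 1}"
    have sub: "?A \<subseteq> VB_window c c'" by blast
    have "closed ?A"
      by (intro continuous_closed_preimage_constant continuous_on_window_d c compact_imp_closed compact_VB_window)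
    from compact_Int_closed[OF compact_VB_window[of c c'] this]
    have "compact ?A" by (simp only: Int_absorb1[OF sub])
    with continuous_on_subset[OF continuous_on_window_slope[OF c] sub]
    show "compact ((\<lambda>z. slope (c, fst z) (c', snd z)) ` ?A)" by (rule compact_continuous_image)
  qed
  moreover have "{slope p q | p q. (p, q) \<in> contacts} = {slope p q | p q. (p, q) \<in> VB l V \<and> d V p q / 2 = 1}"
    by (simp add: contacts_def)
  ultimately show ?thesis
    using window_union[of slope "\<lambda>p q. d V p q / 2 = 1"] by (simp add: d_point_at slope_point_at)
qed

lemma contact_local_min: "(p, q) \<in> contacts \<Longrightarrow> local_min l V (p, q)"
  unfolding local_min_def contacts_def using VB_distance by (auto intro!: exI[of _ 1])

section \<open>Contacts and struts\<close>

text \<open>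
  Near a contact that is not isolated there is a second local minimum of the distance, on a common
  closed pair of edges. Convexity shows that it is a contact with the same chord, so the displacements
  of the two points along their edges agree. Both displacements are nonzero, so the midpoint lies in
  the open cell of the two edges; this puts the whole closed cell into the lifted set.
\<close>

lemma non_isolated_contact:
  assumes contact: "(p, q) \<in> contacts" and component: "fst p = c" "fst q = c'"
    and non_isolated: "\<not> isolated_local_min l V (p, q)"
  obtains i j x x' y y' where
    "is_vertex V c i" "is_vertex V c' j"
    "{x, x'} \<subseteq> {of_int i..of_int i + 1}" "{y, y'} \<subseteq> {of_int j..of_int j + 1}"
    "p = point_at V c x" "q = point_at V c' y"
    "x' \<noteq> x" "y' \<noteq> y"
    "(x' - x) *\<^sub>R edge V c i = (y' - y) *\<^sub>R edge V c' j"
    "((x + x') / 2, (y + y') / 2) \<in> VB_lift l V c c'"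
proof -
  have VB: "(p, q) \<in> VB l V" and d: "d V p q = 2" using contact by (auto simp: contacts_def)
  have c: "c < length V" "c' < length V" using VB_points[OF VB] points_component[of p] points_component[of q] component by simp_all
  obtain e1 where e1: "e1 > 0" "\<And>p'. p' \<in> points V \<Longrightarrow> near V e1 p p' \<Longrightarrow>
    \<exists>i x x'. is_vertex V c i \<and> x \<in> {of_int i..of_int i + 1} \<and> x' \<in> {of_int i..of_int i + 1} \<and>
      point_at V c x = p \<and> point_at V c x' = p' \<and> of_int \<lfloor>x'\<rfloor> \<le> x \<and> x \<le> of_int \<lceil>x'\<rceil>"
    using near_lift[OF closed conjunct1[OF VB_points[OF VB]], unfolded component] by blast
  obtain e2 where e2: "e2 > 0" "\<And>q'. q' \<in> points V \<Longrightarrow> near V e2 q q' \<Longrightarrow>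
    \<exists>i x x'. is_vertex V c' i \<and> x \<in> {of_int i..of_int i + 1} \<and> x' \<in> {of_int i..of_int i + 1} \<and>
      point_at V c' x = q \<and> point_at V c' x' = q' \<and> of_int \<lfloor>x'\<rfloor> \<le> x \<and> x \<le> of_int \<lceil>x'\<rceil>"
    using near_lift[OF closed conjunct2[OF VB_points[OF VB]], unfolded component] by blast
  have "min e1 e2 > 0" using e1(1) e2(1) by simp
  with non_isolated contact_local_min[OF contact] obtain p' q' where
    lm: "local_min l V (p', q')" and near: "near V (min e1 e2) p p'" "near V (min e1 e2) q q'"
    and ne: "(p', q') \<noteq> (p, q)"
    unfolding isolated_local_min_def fst_conv snd_conv by blast
  have VB': "(p', q') \<in> VB l V" using lm by (simp add: local_min_def)
  have "near V e1 p p'" "near V e2 q q'" using near by (auto simp: near_def)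
  note lifts = e1(2)[OF _ this(1)] e2(2)[OF _ this(2)]
  obtain i x x' where
    i: "is_vertex V c i" "x \<in> {of_int i..of_int i + 1}" "x' \<in> {of_int i..of_int i + 1}"
      "point_at V c x = p" "point_at V c x' = p'" "of_int \<lfloor>x'\<rfloor> \<le> x" "x \<le> of_int \<lceil>x'\<rceil>"
    using lifts(1) VB_points[OF VB'] by blast
  obtain j y y' where
    j: "is_vertex V c' j" "y \<in> {of_int j..of_int j + 1}" "y' \<in> {of_int j..of_int j + 1}"
      "point_at V c' y = q" "point_at V c' y' = q'" "of_int \<lfloor>y'\<rfloor> \<le> y" "y \<le> of_int \<lceil>y'\<rceil>"
    using lifts(2) VB_points[OF VB'] by blast
  have lift': "(x', y') \<in> VB_lift l V c c'"
    using VB' point_at_VB_iff[OF closed c, of x' y' l] i j by simp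
  define X where "X s = (1 - s) * x' + s * x" for s
  define Y where "Y s = (1 - s) * y' + s * y" for s
  define D0 where "D0 = pos V p' - pos V q'"
  define D1 where "D1 = pos V p - pos V q"
  have D: "d V (point_at V c (X s)) (point_at V c' (Y s)) = norm ((1 - s) *\<^sub>R D0 + s *\<^sub>R D1)"
    if "0 \<le> s" "s \<le> 1" for s
  proof -
    have "pos V (c, X s) - pos V (c', Y s) = (1 - s) *\<^sub>R D0 + s *\<^sub>R D1"
      unfolding X_def Y_def D0_def D1_def i(4,5)[symmetric] j(4,5)[symmetric] pos_point_at
      using pos_convex_combination[OF i(3,2) that] pos_convex_combination[OF j(3,2) that]
      by (simp add: algebra_simps)
    then show ?thesis by (simp add: d_point_at) (simp add: d_def dist_norm)
  qed
  \<comment> \<open>The segment from the nearby pair to the contact stays in one closed cell.\<close>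
  have lift: "(X s, Y s) \<in> VB_lift l V c c'" if "0 \<le> s" "s \<le> 1" for s
  proof -
    have "(1 - s) *\<^sub>R x' + s *\<^sub>R x \<in> {of_int \<lfloor>x'\<rfloor>..of_int \<lceil>x'\<rceil>}"
      "(1 - s) *\<^sub>R y' + s *\<^sub>R y \<in> {of_int \<lfloor>y'\<rfloor>..of_int \<lceil>y'\<rceil>}"
      using that i(6,7) j(6,7) by (intro convexD_alt; simp)+
    then show ?thesis by (intro VB_lift_cell[OF lift']) (auto simp: X_def Y_def)
  qed
  then have VBs: "(point_at V c (X s), point_at V c' (Y s)) \<in> VB l V" if "0 \<le> s" "s \<le> 1" for s
    using that by (simp add: point_at_VB_iff[OF closed c])
  have D1: "norm D1 = 2" using d by (simp add: D1_def d_def dist_norm)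
  have D0_ge: "2 \<le> norm D0" using VB_distance[OF VB'] by (simp add: D0_def d_def dist_norm)
  obtain e where e: "e > 0" "\<And>p'' q''. (p'', q'') \<in> VB l V \<Longrightarrow> near V e p' p'' \<Longrightarrow> near V e q' q'' \<Longrightarrow>
      d V p' q' \<le> d V p'' q''"
    using lm unfolding local_min_def by auto
  \<comment> \<open>The distance is convex along the segment and ends at \<open>2\<close>. Since the start is a local minimum,
    its distance is at most \<open>2\<close>; so it is a contact as well.\<close>
  have "norm D0 \<le> 2"
  proof -
    define s where "s = min (1/2) (e/2)"
    have s: "0 < s" "s \<le> 1" "s < e" using e(1) by (auto simp: s_def)
    have "x' - X s = s * (x' - x)" "y' - Y s = s * (y' - y)" by (simp_all add: X_def Y_def algebra_simps)
    then have "\<bar>x' - X s\<bar> = s * \<bar>x' - x\<bar>" "\<bar>y' - Y s\<bar> = s * \<bar>y' - y\<bar>"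
      using s(1) by (simp_all add: abs_mult)
    moreover have "s * \<bar>x' - x\<bar> \<le> s * 1" "s * \<bar>y' - y\<bar> \<le> s * 1"
      using i(2,3) j(2,3) s(1) by (intro mult_left_mono; auto simp: abs_le_iff)+
    ultimately have "\<bar>x' - X s\<bar> < e" "\<bar>y' - Y s\<bar> < e" using s by linarith+
    then have "near V e p' (point_at V c (X s))" "near V e q' (point_at V c' (Y s))"
      using near_point_at[of x' "X s" e V c] near_point_at[of y' "Y s" e V c'] by (simp_all add: i(5) j(5))
    then have "d V p' q' \<le> norm ((1 - s) *\<^sub>R D0 + s *\<^sub>R D1)"
      using e(2)[OF VBs, of s] D[of s] s by simp
    moreover have "norm ((1 - s) *\<^sub>R D0 + s *\<^sub>R D1) \<le> (1 - s) * norm D0 + s * 2"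
      using norm_triangle_ineq[of "(1 - s) *\<^sub>R D0" "s *\<^sub>R D1"] s D1 by simp
    ultimately have "norm D0 \<le> (1 - s) * norm D0 + s * 2" by (simp add: D0_def d_def dist_norm)
    then have "s * norm D0 \<le> s * 2" by (simp add: algebra_simps)
    then show ?thesis using s(1) by simp
  qed
  moreover have "2 \<le> norm ((1/2) *\<^sub>R D0 + (1/2) *\<^sub>R D1)"
    using VB_distance[OF VBs[of "1/2"]] D[of "1/2"] by simp
  ultimately have "D0 = D1" using D0_ge D1 by (intro norm_convex_combination_const[of D0 2 D1]) auto
  then have "pos V (c, x') - pos V (c, x) = pos V (c', y') - pos V (c', y)"
    unfolding D0_def D1_def i(4,5)[symmetric] j(4,5)[symmetric] pos_point_at by (simp add: algebra_simps)
  then have parallel: "(x' - x) *\<^sub>R edge V c i = (y' - y) *\<^sub>R edge V c' j"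
    using i(2,3) j(2,3) by (simp add: pos_on_edge[of i] pos_on_edge[of j] algebra_simps)
  \<comment> \<open>Edges are nonzero, so neither of the two points can move without the other.\<close>
  have "x' \<noteq> x \<or> y' \<noteq> y" using ne i(4,5) j(4,5) by auto
  then have "x' \<noteq> x" "y' \<noteq> y"
    using parallel edge_nonzero[OF closed c(1), of i] edge_nonzero[OF closed c(2), of j] by auto
  moreover have "((x + x') / 2, (y + y') / 2) \<in> VB_lift l V c c'"
    using lift[of "1/2"] by (simp add: X_def Y_def field_simps)
  ultimately show thesis
    using i j parallel by (intro that[of i j x x' y y']) auto
qed

text \<open>
  An isolated contact is a strut. Otherwise the line through two neighbouring contacts, cut off by the parameter square of their edges, is a
  maximal family on which the slope is affine. So the slope at \<open>(p, q)\<close> is at least the slope at one of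
  the two endpoints.
\<close>

lemma contact_slope_dominated:
  assumes contact: "(p, q) \<in> contacts"
  shows "\<exists>p' q'. (p', q') \<in> Strut l V \<and> slope p' q' \<le> slope p q"
proof (cases "isolated_local_min l V (p, q)")
  case True
  then have "(p, q) \<in> Strut l V" using contact by (simp add: Strut_def contacts_def)
  then show ?thesis by blast
next
  case False
  obtain c c' where component: "fst p = c" "fst q = c'" by blast
  have VB: "(p, q) \<in> VB l V" and d: "d V p q = 2" using contact by (auto simp: contacts_def)
  have c: "c < length V" "c' < length V" using VB_points[OF VB] points_component[of p] points_component[of q] component by simp_all
  obtain i j x x' y y' where
    vertex: "is_vertex V c i" "is_vertex V c' j" and
    box: "{x, x'} \<subseteq> {of_int i..of_int i + 1}" "{y, y'} \<subseteq> {of_int j..of_int j + 1}" and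
    pq: "p = point_at V c x" "q = point_at V c' y" and
    ne: "x' \<noteq> x" "y' \<noteq> y" and
    parallel: "(x' - x) *\<^sub>R edge V c i = (y' - y) *\<^sub>R edge V c' j" and
    mid: "((x + x') / 2, (y + y') / 2) \<in> VB_lift l V c c'"
    using non_isolated_contact[OF contact component False] .
  define u where "u = x' - x"
  define v where "v = y' - y"
  have uv: "u \<noteq> 0" "v \<noteq> 0" using ne by (auto simp: u_def v_def)
  let ?X = "{of_int i..of_int i + 1::real}" and ?Y = "{of_int j..of_int j + 1::real}"
  obtain s0 s1 where s: "s0 \<le> 0" "1 \<le> s1"
    "\<And>s. x + s * u \<in> ?X \<and> y + s * v \<in> ?Y \<longleftrightarrow> s0 \<le> s \<and> s \<le> s1"
    using line_in_box[OF uv(1), of x "of_int i" "of_int i + 1" y "of_int j" "of_int j + 1" v] box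
    by (auto simp: u_def v_def)
  \<comment> \<open>The midpoint of the two contacts lies in the interior of the parameter square.\<close>
  have cell: "(z, w) \<in> VB_lift l V c c'" if "z \<in> ?X" "w \<in> ?Y" for z w
  proof -
    have strict: "of_int i < (x + x') / 2 \<and> (x + x') / 2 < of_int i + 1"
      "of_int j < (y + y') / 2 \<and> (y + y') / 2 < of_int j + 1"
      using box ne by auto
    then have "\<lfloor>(x + x') / 2\<rfloor> = i" "\<lceil>(x + x') / 2\<rceil> = i + 1" "\<lfloor>(y + y') / 2\<rfloor> = j" "\<lceil>(y + y') / 2\<rceil> = j + 1"
      by (auto simp: floor_eq_iff ceiling_eq_iff)
    then show ?thesis using that by (intro VB_lift_cell[OF mid]) auto
  qed
  have chord: "pos V (c, x + s * u) - pos V (c', y + s * v) = pos V p - pos V q" if "s0 \<le> s" "s \<le> s1" for s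
  proof -
    have "x + s * u \<in> ?X" "y + s * v \<in> ?Y" using s(3)[of s] that by auto
    then have "pos V (c, x + s * u) - pos V (c', y + s * v) =
        pos V (c, x) - pos V (c', y) + s *\<^sub>R (u *\<^sub>R edge V c i - v *\<^sub>R edge V c' j)"
      using box by (simp add: pos_on_edge[of i] pos_on_edge[of j] algebra_simps)
    also have "pos V (c, x) - pos V (c', y) = pos V p - pos V q"
      by (simp add: pq pos_point_at)
    finally show ?thesis using parallel by (simp add: u_def v_def)
  qed
  have on_line: "(point_at V c (x + s * u), point_at V c' (y + s * v)) \<in> contacts" if "s0 \<le> s" "s \<le> s1" for s
    using chord[OF that] d s(3)[of s] that
    by (auto simp: contacts_def point_at_VB_iff[OF closed c] d_point_at cell d_def dist_norm pos_point_at)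
  define L where "L s = (x, y) + s *\<^sub>R (u, v)" for s
  have L: "L s = (x + s * u, y + s * v)" for s by (simp add: L_def)
  have segment: "closed_segment (L s0) (L s1) = L ` {s0..s1}"
  proof -
    have "closed_segment (L s0) (L s1) = L ` closed_segment s0 s1"
    proof -
      have "(1 - \<mu>) *\<^sub>R L s0 + \<mu> *\<^sub>R L s1 = L ((1 - \<mu>) *\<^sub>R s0 + \<mu> *\<^sub>R s1)" for \<mu>
        by (simp add: L algebra_simps)
      then show ?thesis unfolding closed_segment_def by (auto simp: image_iff)
    qed
    then show ?thesis using s(1,2) by (simp add: closed_segment_eq_real_ivl)
  qed
  have family: "min_family l V c i c' j (L s0) (L s1)"
    unfolding min_family_def
  proof (intro conjI vertex)
    have "edge V c i = (1 / u) *\<^sub>R u *\<^sub>R edge V c i" using uv(1) by simp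
    also have "\<dots> = (v / u) *\<^sub>R edge V c' j" using parallel by (simp add: u_def v_def)
    finally show "\<exists>r. edge V c i = r *\<^sub>R edge V c' j" by blast
    show "fst (L s0) \<noteq> fst (L s1)" "snd (L s0) \<noteq> snd (L s1)" using s(1,2) uv by (auto simp: L)
    have "L r \<in> {of_int i..of_int (i + 1)} \<times> {of_int j..of_int (j + 1)}" if "s0 \<le> r" "r \<le> s1" for r
      using s(3)[of r] that by (simp add: L)
    then show "closed_segment (L s0) (L s1) \<subseteq> {of_int i..of_int (i + 1)} \<times> {of_int j..of_int (j + 1)}"
      unfolding segment by (intro image_subsetI) simp
    show "\<forall>(x, y)\<in>closed_segment (L s0) (L s1). local_min l V (point_at V c x, point_at V c' y)"
    proof
      fix z assume "z \<in> closed_segment (L s0) (L s1)"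
      then obtain r where "z = L r" "s0 \<le> r" "r \<le> s1" unfolding segment by auto
      then show "case z of (x, y) \<Rightarrow> local_min l V (point_at V c x, point_at V c' y)"
        using contact_local_min[OF on_line[of r]] by (simp add: L)
    qed
  qed
  \<comment> \<open>A segment that contains this one lies on the same line and in the same square.\<close>
  have maximal: "closed_segment a b = closed_segment (L s0) (L s1)"
    if "min_family l V c i c' j a b" "closed_segment (L s0) (L s1) \<subseteq> closed_segment a b" for a b
  proof
    show "closed_segment a b \<subseteq> closed_segment (L s0) (L s1)"
    proof
      fix z assume z: "z \<in> closed_segment a b"
      have "L s0 \<in> closed_segment a b" "L s1 \<in> closed_segment a b" using that(2) by auto
      with z obtain \<mu> \<alpha> \<beta> where z_eq: "z = (1 - \<mu>) *\<^sub>R a + \<mu> *\<^sub>R b"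
        and L0: "L s0 = (1 - \<alpha>) *\<^sub>R a + \<alpha> *\<^sub>R b" and L1: "L s1 = (1 - \<beta>) *\<^sub>R a + \<beta> *\<^sub>R b"
        unfolding closed_segment_def by blast
      have "L s0 \<noteq> L s1" using s(1,2) uv by (auto simp: L)
      then have ne: "\<beta> - \<alpha> \<noteq> 0" using L0 L1 by auto
      define r where "r = (\<mu> - \<alpha>) / (\<beta> - \<alpha>)"
      have r: "\<mu> = \<alpha> + r * (\<beta> - \<alpha>)" using ne by (simp add: r_def)
      have "z = L s0 + r *\<^sub>R (L s1 - L s0)"
        unfolding z_eq L0 L1 r by (simp add: algebra_simps)
      also have "\<dots> = L (s0 + r * (s1 - s0))" by (simp add: L algebra_simps)
      finally have z_L: "z = L (s0 + r * (s1 - s0))" .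
      have "z \<in> {of_int i..of_int (i + 1)} \<times> {of_int j..of_int (j + 1)}"
        using z that(1) unfolding min_family_def by blast
      then have "s0 + r * (s1 - s0) \<in> {s0..s1}"
        using s(3)[of "s0 + r * (s1 - s0)"] unfolding z_L L by simp
      then show "z \<in> closed_segment (L s0) (L s1)" unfolding segment z_L by (rule imageI)
    qed
  qed (rule that(2))
  have strut: "(point_at V c (fst (L s')), point_at V c' (snd (L s'))) \<in> Strut l V" if "s' = s0 \<or> s' = s1" for s'
  proof -
    note commute = closed_segment_commute[of "L s1" "L s0"]
    have family': "min_family l V c i c' j (L s1) (L s0)"
      using family unfolding min_family_def commute by (elim conjE, intro conjI) (assumption | erule not_sym)+
    have "family_endpoint l V (point_at V c (fst (L s0)), point_at V c' (snd (L s0)))"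
      unfolding family_endpoint_def
      by (rule exI[of _ c], rule exI[of _ i], rule exI[of _ c'], rule exI[of _ j], rule exI[of _ "L s0"],
          rule exI[of _ "L s1"], intro conjI allI impI family refl) (elim conjE, rule maximal)
    moreover have "family_endpoint l V (point_at V c (fst (L s1)), point_at V c' (snd (L s1)))"
      unfolding family_endpoint_def commute
      by (rule exI[of _ c], rule exI[of _ i], rule exI[of _ c'], rule exI[of _ j], rule exI[of _ "L s1"],
          rule exI[of _ "L s0"], unfold commute, intro conjI allI impI family' refl) (elim conjE, rule maximal)
    ultimately have "family_endpoint l V (point_at V c (fst (L s')), point_at V c' (snd (L s')))"
      using that by blast
    moreover have "(point_at V c (fst (L s')), point_at V c' (snd (L s'))) \<in> contacts"
      using on_line[of s'] that s(1,2) by (auto simp: L)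
    ultimately show ?thesis by (simp add: Strut_def contacts_def)
  qed
  \<comment> \<open>With a constant chord, the slope is affine along the family, with increment \<open>B\<close>.\<close>
  define B where "B = (u *\<^sub>R edge W c i - v *\<^sub>R edge W c' j) \<bullet> (pos V p - pos V q) / 4"
  have slope_line: "slope (point_at V c (x + s * u)) (point_at V c' (y + s * v)) = slope p q + s * B"
    if "s0 \<le> s" "s \<le> s1" for s
  proof -
    have "x + s * u \<in> ?X" "y + s * v \<in> ?Y" using s(3)[of s] that by auto
    then have W: "pos W (c, x + s * u) - pos W (c', y + s * v) =
        pos W (c, x) - pos W (c', y) + s *\<^sub>R (u *\<^sub>R edge W c i - v *\<^sub>R edge W c' j)"
      using box by (simp add: pos_on_edge[of i] pos_on_edge[of j] algebra_simps)
    have "slope (point_at V c (x + s * u)) (point_at V c' (y + s * v)) =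
        (pos W (c, x + s * u) - pos W (c', y + s * v)) \<bullet> (pos V p - pos V q) / 4"
      unfolding slope_point_at[OF c] using chord[OF that] d by (simp add: slope_def d_def dist_norm)
    also have "\<dots> = (pos W (c, x) - pos W (c', y)) \<bullet> (pos V p - pos V q) / 4 + s * B"
      unfolding W B_def by (simp only: inner_add_left inner_scaleR_left) (simp add: add_divide_distrib)
    also have "(pos W (c, x) - pos W (c', y)) \<bullet> (pos V p - pos V q) / 4 = slope (c, x) (c', y)"
      using chord[of 0] s(1,2) d by (simp add: slope_def d_def dist_norm)
    also have "\<dots> = slope p q"
      unfolding pq by (rule slope_point_at[OF c, symmetric])
    finally show ?thesis .
  qed
  have endpoint: ?thesis if "s' = s0 \<or> s' = s1" "s' * B \<le> 0" for s'
  proof (intro exI conjI)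
    show "(point_at V c (x + s' * u), point_at V c' (y + s' * v)) \<in> Strut l V"
      using strut[OF that(1)] by (simp add: L)
    show "slope (point_at V c (x + s' * u)) (point_at V c' (y + s' * v)) \<le> slope p q"
      using slope_line[of s'] that s(1,2) by auto
  qed
  show ?thesis
  proof (cases "B \<ge> 0")
    case True
    then show ?thesis using endpoint[of s0] s(1) by (simp add: mult_le_0_iff)
  next
    case False
    then show ?thesis using endpoint[of s1] s(2) by (simp add: mult_le_0_iff)
  qed
qed

section \<open>The derivative of constraint thickness\<close>

definition kink_slopes :: "real set" where
  "kink_slopes = {fwd_deriv (\<lambda>t. min_rad_side s (vary V W t) c k) | c k s. (c, k, s) \<in> Kink V}"

definition contact_slopes :: "real set" where
  "contact_slopes = {slope p q | p q. (p, q) \<in> contacts}"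

lemma bent_min_rad_side_differentiable:
  assumes "is_vertex V c k" "turn V c k \<noteq> 0"
  shows "(\<lambda>t. min_rad_side s (vary V W t) c k) differentiable (at 0)"
  using min_rad_side_vary_differentiable bent_turn[OF assms] assms(1) by (auto simp: is_vertex_def)

lemma eventually_bent:
  assumes "is_vertex V c k" "turn V c k \<noteq> 0"
  shows "eventually (\<lambda>t. turn (vary V W t) c k \<noteq> 0) (at_right 0)"
proof -
  have "((\<lambda>t. turn (vary V W t) c k) \<longlongrightarrow> turn V c k) (at_right 0)"
    using turn_vary_tendsto assms(1) by (simp add: is_vertex_def)
  then show ?thesis using tendsto_imp_eventually_ne assms(2) by blast
qed

lemma bent_vertex: obtains c k where "is_vertex V c k" "turn V c k \<noteq> 0"
  using exists_bent_vertex[OF closed, of 0] closed by (auto simp: closed_polygon_def)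

lemma finite_kink_slopes: "finite kink_slopes"
proof -
  let ?f = "\<lambda>((c, k), s). fwd_deriv (\<lambda>t. min_rad_side s (vary V W t) c k)"
  have "UNIV = {Minus, Plus}" using side.exhaust by blast
  then have "finite (UNIV :: side set)" by (metis finite.simps)
  then have "finite (?f ` ({(c, k). is_vertex V c k} \<times> UNIV))"
    by (intro finite_imageI finite_cartesian_product finite_vertices)
  moreover have "kink_slopes \<subseteq> ?f ` ({(c, k). is_vertex V c k} \<times> UNIV)"
  proof
    fix r assume "r \<in> kink_slopes"
    then obtain c k s where "is_vertex V c k" "r = fwd_deriv (\<lambda>t. min_rad_side s (vary V W t) c k)"
      by (auto simp: kink_slopes_def Kink_def)
    then show "r \<in> ?f ` ({(c, k). is_vertex V c k} \<times> UNIV)"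
      by (intro image_eqI[of _ _ "((c, k), s)"]) auto
  qed
  ultimately show ?thesis by (rule finite_subset[rotated])
qed

text \<open>
  The value \<open>1\<close> of the infimum is attained, since the set of all radii and half distances is compact.
\<close>

lemma active_slopes_nonempty: "kink_slopes \<union> contact_slopes \<noteq> {}"
proof -
  let ?R = "{min_rad V c k | c k. is_vertex V c k \<and> turn V c k \<noteq> 0}"
  let ?D = "{d V p q / 2 | p q. (p, q) \<in> VB l V}"
  have "?R \<subseteq> (\<lambda>(c, k). min_rad V c k) ` {(c, k). is_vertex V c k}" by auto
  then have "finite ?R" using finite_vertices finite_surj by blast
  then have "closed (?R \<union> ?D)"
    by (intro closed_Un compact_imp_closed finite_imp_compact compact_VB_distances)
  moreover obtain c k where "is_vertex V c k" "turn V c k \<noteq> 0" by (rule bent_vertex)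
  then have "?R \<union> ?D \<noteq> {}" by blast
  ultimately have "Inf (?R \<union> ?D) \<in> ?R \<union> ?D"
    by (intro closed_contains_Inf bdd_below_clearances)
  then have "1 \<in> ?R \<union> ?D" by (simp only: thick[unfolded CThi_def])
  then show ?thesis
  proof
    assume "1 \<in> ?R"
    then obtain c k where ck: "is_vertex V c k" "turn V c k \<noteq> 0" and "min_rad V c k = 1" by auto
    then obtain s where "min_rad_side s V c k = 1"
      unfolding min_rad_def by (metis min_def)
    then have "(c, k, s) \<in> Kink V" using ck by (simp add: Kink_def)
    then show ?thesis unfolding kink_slopes_def by blast
  next
    assume "1 \<in> ?D"
    then obtain p q where "(p, q) \<in> VB l V" "d V p q = 2" by auto
    then have "(p, q) \<in> contacts" by (simp add: contacts_def)
    then show ?thesis unfolding contact_slopes_def by blast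
  qed
qed

lemma radius_eventually_lower_bound:
  assumes m: "\<And>r. r \<in> kink_slopes \<Longrightarrow> m \<le> r" and "e > 0" and vertex: "is_vertex V c k"
  shows "eventually (\<lambda>t. turn (vary V W t) c k \<noteq> 0 \<longrightarrow> 1 + t * (m - e) \<le> min_rad_side s (vary V W t) c k) (at_right 0)"
proof -
  let ?g = "\<lambda>t. min_rad_side s (vary V W t) c k"
  have c: "c < length V" using vertex by (simp add: is_vertex_def)
  have line: "((\<lambda>t. 1 + t * (m - e)) \<longlongrightarrow> 1 + 0 * (m - e)) (at_right 0)"
    by (intro tendsto_intros)
  show ?thesis
  proof (cases "turn V c k = 0")
    case True
    have "eventually (\<lambda>t. 1 + t * (m - e) < 2) (at_right 0)"
      using line by (intro order_tendstoD(2)) auto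
    with min_rad_side_vary_straight[OF c True, of s] show ?thesis
      by eventually_elim auto
  next
    case False
    note diff = differentiable_fwd[OF bent_min_rad_side_differentiable[OF vertex False, of s]]
    show ?thesis
    proof (cases "min_rad_side s V c k = 1")
      case True
      then have "m \<le> fwd_deriv ?g"
        using vertex False by (intro m) (auto simp: kink_slopes_def Kink_def)
      then have le: "t * (m - e) \<le> t * (fwd_deriv ?g - e)" if "0 < t" for t
        using that by simp
      from fwd_deriv_bounds[OF diff(1) \<open>e > 0\<close>] at_right_eventually_pos show ?thesis
        unfolding vary_zero True
      proof eventually_elim
        case (elim t)
        then show ?case using le[of t] by linarith
      qed
    next
      case gt: False
      have "continuous (at_right 0) ?g" by (rule differentiable_imp_continuous_within[OF diff(2)])
      then have "(?g \<longlongrightarrow> min_rad_side s V c k) (at_right 0)" by (simp add: continuous_within)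
      from tendsto_diff[OF this line]
      have "((\<lambda>t. ?g t - (1 + t * (m - e))) \<longlongrightarrow> min_rad_side s V c k - 1) (at_right 0)" by simp
      moreover have "0 < min_rad_side s V c k - 1"
        using bent_min_rad_side[OF vertex False, of s] gt by simp
      ultimately have "eventually (\<lambda>t. 0 < ?g t - (1 + t * (m - e))) (at_right 0)"
        by (rule order_tendstoD(1))
      then show ?thesis by eventually_elim auto
    qed
  qed
qed

lemma CThi_eventually_lower_bound:
  assumes m: "\<And>r. r \<in> kink_slopes \<union> contact_slopes \<Longrightarrow> m \<le> r" and "e > 0"
  shows "eventually (\<lambda>t. 1 + t * (m - e) \<le> CThi l (vary V W t)) (at_right 0)"
proof -
  have m_kink: "m \<le> r" if "r \<in> kink_slopes" for r using m that by blast
  have "eventually (\<lambda>t. \<forall>z\<in>{(c, k). is_vertex V c k}. case z of (c, k) \<Rightarrow> turn (vary V W t) c k \<noteq> 0 \<longrightarrow>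
      1 + t * (m - e) \<le> min_rad (vary V W t) c k) (at_right 0)"
  proof (rule eventually_ball_finite[OF finite_vertices], clarify)
    fix c k assume "is_vertex V c k"
    then have bound: "eventually (\<lambda>t. turn (vary V W t) c k \<noteq> 0 \<longrightarrow>
        1 + t * (m - e) \<le> min_rad_side s (vary V W t) c k) (at_right 0)" for s
      by (intro radius_eventually_lower_bound m_kink \<open>e > 0\<close>)
    from bound[of Minus] bound[of Plus]
    show "eventually (\<lambda>t. turn (vary V W t) c k \<noteq> 0 \<longrightarrow> 1 + t * (m - e) \<le> min_rad (vary V W t) c k) (at_right 0)"
      by eventually_elim (auto simp: min_rad_def)
  qed
  moreover have "eventually (\<lambda>t. \<forall>(p, q) \<in> VB l V. 1 + t * (m - e) \<le> d (vary V W t) p q / 2) (at_right 0)"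
    by (rule VB_eventually_lower_bound[OF m \<open>e > 0\<close>]) (unfold contact_slopes_def, blast)
  moreover obtain c k where ck: "is_vertex V c k" "turn V c k \<noteq> 0" by (rule bent_vertex)
  note eventually_bent[OF ck]
  ultimately show ?thesis
  proof eventually_elim
    case (elim t)
    let ?R = "{min_rad (vary V W t) c k | c k. is_vertex (vary V W t) c k \<and> turn (vary V W t) c k \<noteq> 0}"
    let ?D = "{d (vary V W t) p q / 2 | p q. (p, q) \<in> VB l (vary V W t)}"
    show ?case unfolding CThi_def
    proof (rule cInf_greatest)
      show "?R \<union> ?D \<noteq> {}" using elim(3) ck(1) by auto
      fix r assume "r \<in> ?R \<union> ?D"
      then show "1 + t * (m - e) \<le> r"
      proof
        assume "r \<in> ?R"
        then obtain c k where "is_vertex V c k" "turn (vary V W t) c k \<noteq> 0" "r = min_rad (vary V W t) c k"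
          by auto
        then show ?thesis using elim(1) by blast
      next
        assume "r \<in> ?D"
        then obtain p q where "(p, q) \<in> VB l V" "r = d (vary V W t) p q / 2"
          unfolding VB_vary by blast
        then show ?thesis using elim(2) by blast
      qed
    qed
  qed
qed

lemma CThi_eventually_upper_bound:
  assumes "m \<in> kink_slopes \<union> contact_slopes" and "e > 0"
  shows "eventually (\<lambda>t. CThi l (vary V W t) \<le> 1 + t * (m + e)) (at_right 0)"
  using assms(1)
proof
  assume "m \<in> kink_slopes"
  then obtain c k s where ck: "is_vertex V c k" "turn V c k \<noteq> 0" and s: "min_rad_side s V c k = 1"
    and m: "m = fwd_deriv (\<lambda>t. min_rad_side s (vary V W t) c k)"
    by (auto simp: kink_slopes_def Kink_def)
  from fwd_deriv_bounds[OF differentiable_fwd(1)[OF bent_min_rad_side_differentiable[OF ck, of s]] \<open>e > 0\<close>]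
    eventually_bent[OF ck]
  show ?thesis unfolding vary_zero s m[symmetric]
  proof eventually_elim
    case (elim t)
    have "CThi l (vary V W t) \<le> min_rad (vary V W t) c k"
      unfolding CThi_def using elim(2) ck(1) by (intro cInf_lower bdd_below_clearances) auto
    also have "\<dots> \<le> min_rad_side s (vary V W t) c k"
      by (cases s) (simp_all add: min_rad_def)
    finally show ?case using elim(1) by simp
  qed
next
  assume "m \<in> contact_slopes"
  then obtain p q where VB: "(p, q) \<in> VB l V" and d: "d V p q = 2" and m: "m = slope p q"
    by (auto simp: contact_slopes_def contacts_def)
  from fwd_deriv_bounds[OF d_vary_has_derivative[OF VB] \<open>e > 0\<close>]
  show ?thesis unfolding vary_zero d m[symmetric]
  proof eventually_elim
    case (elim t)
    have "d (vary V W t) p q / 2 \<in> {d (vary V W t) p q / 2 | p q. (p, q) \<in> VB l (vary V W t)}"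
      unfolding VB_vary using VB by blast
    then have "CThi l (vary V W t) \<le> d (vary V W t) p q / 2"
      unfolding CThi_def by (intro cInf_lower bdd_below_clearances UnI2)
    then show ?case using elim by simp
  qed
qed

lemma CThi_has_derivative:
  assumes "is_minimum m (kink_slopes \<union> contact_slopes)"
  shows "((\<lambda>t. CThi l (vary V W t)) has_vector_derivative m) (at_right 0)"
proof (rule fwd_deriv_sandwich)
  fix e :: real assume "e > 0"
  show "eventually (\<lambda>t. CThi l (vary V W 0) + t * (m - e) \<le> CThi l (vary V W t)) (at_right 0)"
    unfolding vary_zero thick using assms
    by (intro CThi_eventually_lower_bound \<open>e > 0\<close>) (simp add: is_minimum_def)
  show "eventually (\<lambda>t. CThi l (vary V W t) \<le> CThi l (vary V W 0) + t * (m + e)) (at_right 0)"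
    unfolding vary_zero thick using assms
    by (intro CThi_eventually_upper_bound \<open>e > 0\<close>) (simp add: is_minimum_def)
qed

end

theorem proposition2p11:
  fixes l :: real and V W :: "(real ^ 3) list list"
  assumes "l > 0"
    and "closed_polygon V"
    and "map length W = map length V"
    and "CThi l V = 1"
  shows "let KD = {fwd_deriv (\<lambda>t. min_rad_side s (vary V W t) c k) | c k s. (c, k, s) \<in> Kink V};
             SD = {fwd_deriv (\<lambda>t. d (vary V W t) p q / 2) | p q. (p, q) \<in> Strut l V}
         in (\<forall>(c, k, s) \<in> Kink V. (\<lambda>t. min_rad_side s (vary V W t) c k) differentiable (at_right 0)) \<and>
            (\<forall>(p, q) \<in> Strut l V. (\<lambda>t. d (vary V W t) p q / 2) differentiable (at_right 0)) \<and>
            (\<lambda>t. CThi l (vary V W t)) differentiable (at_right 0) \<and>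
            (KD \<noteq> {} \<longrightarrow> (\<exists>m. is_minimum m KD)) \<and>
            (SD \<noteq> {} \<longrightarrow> (\<exists>m. is_minimum m SD)) \<and>
            is_minimum (fwd_deriv (\<lambda>t. CThi l (vary V W t))) (KD \<union> SD)"
proof -
  interpret thick_polygon_variation V W l
    using assms(2-4) by unfold_locales
  have contact: "(p, q) \<in> contacts" if "(p, q) \<in> Strut l V" for p q
    using that by (auto simp: Strut_def contacts_def)
  then have VB: "(p, q) \<in> VB l V" if "(p, q) \<in> Strut l V" for p q
    using that by (auto simp: contacts_def)
  define strut_slopes where "strut_slopes = {fwd_deriv (\<lambda>t. d (vary V W t) p q / 2) | p q. (p, q) \<in> Strut l V}"
  have strut_slopes: "strut_slopes = {slope p q | p q. (p, q) \<in> Strut l V}"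
  proof -
    have "fwd_deriv (\<lambda>t. d (vary V W t) p q / 2) = slope p q" if "(p, q) \<in> Strut l V" for p q
      using that by (intro fwd_deriv_eqI d_vary_has_derivative VB)
    then have "r = fwd_deriv (\<lambda>t. d (vary V W t) p q / 2) \<and> (p, q) \<in> Strut l V \<longleftrightarrow>
        r = slope p q \<and> (p, q) \<in> Strut l V" for r p q by metis
    then show ?thesis unfolding strut_slopes_def by (simp only:)
  qed
  then have sub: "strut_slopes \<subseteq> contact_slopes" using contact unfolding contact_slopes_def by blast
  have dominated: "\<exists>r'\<in>strut_slopes. r' \<le> r" if "r \<in> contact_slopes" for r
    using that contact_slope_dominated unfolding contact_slopes_def strut_slopes by blast
  have to_struts: "is_minimum m (K \<union> strut_slopes)" if "is_minimum m (K \<union> contact_slopes)" for m K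
  proof -
    have "m \<in> K \<union> strut_slopes"
    proof (cases "m \<in> K")
      case False
      then have "m \<in> contact_slopes" using that by (simp add: is_minimum_def)
      then obtain r where r: "r \<in> strut_slopes" "r \<le> m" using dominated by blast
      then have "m \<le> r" using that sub unfolding is_minimum_def by blast
      then have "m = r" using r(2) by simp
      then show ?thesis using r(1) by simp
    qed simp
    then show ?thesis using that sub unfolding is_minimum_def by blast
  qed
  have contact_compact: "compact contact_slopes"
    using compact_contact_slopes by (simp add: contact_slopes_def)
  obtain m where m: "is_minimum m (kink_slopes \<union> contact_slopes)"
    using compact_has_minimum[OF compact_Un[OF finite_imp_compact[OF finite_kink_slopes] contact_compact]
        active_slopes_nonempty] .
  have "is_minimum (fwd_deriv (\<lambda>t. CThi l (vary V W t))) (kink_slopes \<union> strut_slopes)"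
    using fwd_deriv_eqI[OF CThi_has_derivative[OF m]] to_struts[OF m] by simp
  moreover have "(\<lambda>t. CThi l (vary V W t)) differentiable (at_right 0)"
    by (rule differentiableI_vector[OF CThi_has_derivative[OF m]])
  moreover have "\<exists>m. is_minimum m kink_slopes" if "kink_slopes \<noteq> {}"
    using compact_has_minimum[OF finite_imp_compact[OF finite_kink_slopes] that] by blast
  moreover have "\<exists>m. is_minimum m strut_slopes" if "strut_slopes \<noteq> {}"
  proof -
    have "contact_slopes \<noteq> {}" using that sub by blast
    then obtain m where "is_minimum m contact_slopes"
      using compact_has_minimum[OF contact_compact] by blast
    then show ?thesis using to_struts[of m "{}"] by auto
  qed
  moreover have "\<forall>(c, k, s) \<in> Kink V. (\<lambda>t. min_rad_side s (vary V W t) c k) differentiable (at_right 0)"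
  proof clarify
    fix c k s assume "(c, k, s) \<in> Kink V"
    then show "(\<lambda>t. min_rad_side s (vary V W t) c k) differentiable (at_right 0)"
      by (intro differentiable_fwd(2) bent_min_rad_side_differentiable) (simp_all add: Kink_def)
  qed
  moreover have "\<forall>(p, q) \<in> Strut l V. (\<lambda>t. d (vary V W t) p q / 2) differentiable (at_right 0)"
  proof clarify
    fix c x c' y assume "((c, x), (c', y)) \<in> Strut l V"
    then show "(\<lambda>t. d (vary V W t) (c, x) (c', y) / 2) differentiable (at_right 0)"
      by (intro differentiableI_vector[OF d_vary_has_derivative] VB)
  qed
  ultimately show ?thesis
    unfolding Let_def kink_slopes_def[symmetric] strut_slopes_def[symmetric] by (intro conjI impI)
qed

end
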